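(* Let $\mathfrak{g}$ be a finite-dimensional complex simple Lie algebra. Suppose $f=(t-a)(t-b)\in\mathbb{C}[t]$ with $a,b\in\mathbb{C}$, $a\ne b$, and let $I=\langle f\rangle$ be the ideal of $\mathbb{C}[t]$ generated by $f$. Then $\operatorname{H}_2(\mathfrak{g}\otimes I,\mathbb{C})$ and $\operatorname{H}^2(\mathfrak{g}\otimes I,\mathbb{C})$ are finite-dimensional.
   Context: $\mathfrak{g}\otimes I$ is an ideal (hence a Lie subalgebra) of $\mathfrak{g}[t]=\mathfrak{g}\otimes_{\mathbb{C}}\mathbb{C}[t]$, which has bracket $[x\otimes p,y\otimes q]=[x,y]\otimes pq$. $\operatorname{H}_2$ and $\operatorname{H}^2$ are Lie algebra homology and cohomology over $\mathbb{C}$ with trivial coefficients. *)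

theory Defs
  imports
    Complex_Main
    "HOL-Library.Function_Algebras"
    "HOL-Library.Poly_Mapping"
    "HOL-Computational_Algebra.Polynomial"
begin

section \<open>Lie algebras\<close>

locale lie_algebra = vector_space scale
  for scale :: "'k::field \<Rightarrow> 'g::ab_group_add \<Rightarrow> 'g" +
  fixes bracket :: "'g \<Rightarrow> 'g \<Rightarrow> 'g"
  assumes bracket_linear_left: "Vector_Spaces.linear scale scale (\<lambda>x. bracket x y)"
    and bracket_linear_right: "Vector_Spaces.linear scale scale (bracket x)"
    and bracket_self: "bracket x x = 0"
    and jacobi: "bracket x (bracket y z) + bracket y (bracket z x) + bracket z (bracket x y) = 0"
begin

definition lie_ideal :: "'g set \<Rightarrow> bool"
  where "lie_ideal J \<longleftrightarrow> subspace J \<and> (\<forall>x. \<forall>y\<in>J. bracket x y \<in> J)"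

end

locale simple_lie_algebra = lie_algebra +
  assumes nonabelian: "\<exists>x y. bracket x y \<noteq> 0"
    and ideal_trivial: "lie_ideal J \<Longrightarrow> J = {0} \<or> J = UNIV"


section \<open>The Lie algebra of polynomials with coefficients in a Lie algebra\<close>

text \<open>
  \<open>\<gg>[t] = \<gg> \<otimes> k[t]\<close> is the type \<open>'g poly\<close>, a pure tensor \<open>x \<otimes> p\<close> being the polynomial whose
  \<open>n\<close>-th coefficient is the \<open>n\<close>-th coefficient of \<open>p\<close> times \<open>x\<close>.
\<close>

definition poly_scale :: "('k::field \<Rightarrow> 'g::ab_group_add \<Rightarrow> 'g) \<Rightarrow> 'k \<Rightarrow> 'g poly \<Rightarrow> 'g poly"
  where "poly_scale scale c P = map_poly (scale c) P"

definition poly_bracket :: "('g::ab_group_add \<Rightarrow> 'g \<Rightarrow> 'g) \<Rightarrow> 'g poly \<Rightarrow> 'g poly \<Rightarrow> 'g poly"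
  where "poly_bracket bracket P Q =
    (\<Sum>i\<le>degree P. \<Sum>j\<le>degree Q. monom (bracket (coeff P i) (coeff Q j)) (i + j))"

definition poly_tensor :: "('k::field \<Rightarrow> 'g::ab_group_add \<Rightarrow> 'g) \<Rightarrow> 'g \<Rightarrow> 'k poly \<Rightarrow> 'g poly"
  where "poly_tensor scale x p = map_poly (\<lambda>c. scale c x) p"

text \<open>
  Tensoring over a field is exact, so \<open>\<gg> \<otimes> I\<close> is the subspace of \<open>\<gg>[t]\<close> spanned by the
  pure tensors \<open>x \<otimes> p\<close> with \<open>p \<in> I\<close>.
\<close>

definition tensor_ideal :: "('k::field \<Rightarrow> 'g::ab_group_add \<Rightarrow> 'g) \<Rightarrow> 'k poly set \<Rightarrow> 'g poly set"
  where "tensor_ideal scale I = module.span (poly_scale scale) {poly_tensor scale x p | x p. p \<in> I}"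

lemma poly_eq_sum_monom: "p = (\<Sum>i\<le>degree p. monom (coeff p i) i)"
  by (rule poly_eqI) (auto simp: coeff_sum coeff_eq_0 not_le)

lemma poly_monom_add_induct:
  assumes "\<And>a n. Pr (monom a n)" "\<And>p q. Pr p \<Longrightarrow> Pr q \<Longrightarrow> Pr (p + q)"
  shows "Pr (p :: 'a::ab_group_add poly)"
proof -
  have "Pr (\<Sum>i\<in>A. monom (coeff p i) i)" if "finite A" for A
    using that
  proof (induction A rule: finite_induct)
    case empty
    then show ?case using assms(1)[of 0 0] by simp
  next
    case (insert x F)
    then show ?case using assms by simp
  qed
  then show ?thesis using poly_eq_sum_monom[of p] by (metis finite_atMost)
qed

context lie_algebra
begin

lemma bracket_add_left: "bracket (x + y) z = bracket x z + bracket y z"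
  by (rule module_hom.add[OF bracket_linear_left[unfolded linear_iff_module_hom]])

lemma bracket_add_right: "bracket z (x + y) = bracket z x + bracket z y"
  by (rule module_hom.add[OF bracket_linear_right[unfolded linear_iff_module_hom]])

lemma bracket_scale_left: "bracket (scale c x) z = scale c (bracket x z)"
  by (rule module_hom.scale[OF bracket_linear_left[unfolded linear_iff_module_hom]])

lemma bracket_scale_right: "bracket z (scale c x) = scale c (bracket z x)"
  by (rule module_hom.scale[OF bracket_linear_right[unfolded linear_iff_module_hom]])

lemma bracket_zero [simp]: "bracket 0 z = 0" "bracket z 0 = 0"
  using bracket_add_left[of 0 0 z] bracket_add_right[of z 0 0] by auto

lemma bracket_anticomm: "bracket x y = - bracket y x"
proof -
  have "bracket (x + y) (x + y) = bracket x x + (bracket x y + bracket y x) + bracket y y"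
    by (simp only: bracket_add_left bracket_add_right ac_simps)
  then show ?thesis
    by (simp add: bracket_self eq_neg_iff_add_eq_0)
qed

lemma coeff_poly_scale [simp]: "coeff (poly_scale scale c P) n = scale c (coeff P n)"
  by (simp add: poly_scale_def coeff_map_poly)

lemma coeff_poly_tensor [simp]: "coeff (poly_tensor scale x p) n = scale (coeff p n) x"
  by (simp add: poly_tensor_def coeff_map_poly)

lemma coeff_poly_bracket:
  "coeff (poly_bracket bracket P Q) n = (\<Sum>i\<le>n. bracket (coeff P i) (coeff Q (n - i)))"
proof -
  have inner: "(\<Sum>j\<le>degree Q. coeff (monom (bracket (coeff P i) (coeff Q j)) (i + j)) n)
      = (if i \<le> n then bracket (coeff P i) (coeff Q (n - i)) else 0)" for i
  proof (cases "i \<le> n")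
    case True
    have "(\<Sum>j\<le>degree Q. coeff (monom (bracket (coeff P i) (coeff Q j)) (i + j)) n)
       = (\<Sum>j\<le>degree Q. if j = n - i then bracket (coeff P i) (coeff Q j) else 0)"
      using True by (intro sum.cong) auto
    also have "\<dots> = bracket (coeff P i) (coeff Q (n - i))"
      by (auto simp: coeff_eq_0 not_le)
    finally show ?thesis using True by simp
  next
    case False
    then show ?thesis by auto
  qed
  have "coeff (poly_bracket bracket P Q) n
      = (\<Sum>i\<le>degree P. if i \<le> n then bracket (coeff P i) (coeff Q (n - i)) else 0)"
    by (simp only: poly_bracket_def coeff_sum inner)
  also have "\<dots> = (\<Sum>i\<in>{..degree P} \<inter> {..n}. bracket (coeff P i) (coeff Q (n - i)))"
    by (simp only: sum.inter_restrict finite_atMost atMost_iff)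
  also have "\<dots> = (\<Sum>i\<le>n. bracket (coeff P i) (coeff Q (n - i)))"
    by (rule sum.mono_neutral_left) (use le_degree[of P] in force)+
  finally show ?thesis .
qed

lemma poly_bracket_tensor:
  "poly_bracket bracket (poly_tensor scale x p) (poly_tensor scale y q)
     = poly_tensor scale (bracket x y) (p * q)"
  by (rule poly_eqI)
    (simp add: coeff_poly_bracket coeff_mult bracket_scale_left bracket_scale_right scale_sum_left mult.commute)

lemma poly_bracket_monom:
  "poly_bracket bracket (monom x i) (monom y j) = monom (bracket x y) (i + j)"
proof -
  have *: "monom x i = poly_tensor scale x (monom 1 i)" for x i
    by (rule poly_eqI) simp
  show ?thesis by (simp only: * poly_bracket_tensor mult_monom) simp
qed

lemma poly_bracket_add:
  "poly_bracket bracket (P + P') Q = poly_bracket bracket P Q + poly_bracket bracket P' Q"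
  "poly_bracket bracket Q (P + P') = poly_bracket bracket Q P + poly_bracket bracket Q P'"
  by (auto intro!: poly_eqI
      simp: coeff_poly_bracket bracket_add_left bracket_add_right sum.distrib)

lemma poly_bracket_scale:
  "poly_bracket bracket (poly_scale scale c P) Q = poly_scale scale c (poly_bracket bracket P Q)"
  "poly_bracket bracket Q (poly_scale scale c P) = poly_scale scale c (poly_bracket bracket Q P)"
  by (auto intro!: poly_eqI
      simp: coeff_poly_bracket bracket_scale_left bracket_scale_right scale_sum_right)

lemma vector_space_poly_scale: "vector_space (poly_scale scale)"
  by unfold_locales (auto intro!: poly_eqI simp: scale_right_distrib scale_left_distrib)

lemma poly_bracket_anticomm: "poly_bracket bracket P Q = - poly_bracket bracket Q P"
proof (induction P rule: poly_monom_add_induct)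
  case (1 a n)
  show ?case
  proof (induction Q rule: poly_monom_add_induct)
    case (1 b m)
    show ?case
      by (simp only: poly_bracket_monom bracket_anticomm[of a b] minus_monom add.commute[of n m])
  qed (simp add: poly_bracket_add)
qed (simp add: poly_bracket_add)

lemma poly_bracket_self: "poly_bracket bracket P P = 0"
proof (induction P rule: poly_monom_add_induct)
  case (1 a n)
  then show ?case by (simp add: poly_bracket_monom bracket_self)
next
  case (2 p q)
  then show ?case using poly_bracket_anticomm[of p q] by (simp add: poly_bracket_add)
qed

lemma poly_bracket_jacobi:
  "poly_bracket bracket P (poly_bracket bracket Q R) + poly_bracket bracket Q (poly_bracket bracket R P)
     + poly_bracket bracket R (poly_bracket bracket P Q) = 0" (is "?J P Q R = 0")
proof (induction P rule: poly_monom_add_induct)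
  case (1 a n)
  show ?case
  proof (induction Q rule: poly_monom_add_induct)
    case (1 b m)
    show ?case
    proof (induction R rule: poly_monom_add_induct)
      case (1 c l)
      have "?J (monom a n) (monom b m) (monom c l)
          = monom (bracket a (bracket b c) + bracket b (bracket c a) + bracket c (bracket a b)) (n + m + l)"
        by (simp only: poly_bracket_monom add_monom[symmetric] add.assoc add.commute[of l]
            add.left_commute[of m n])
      then show ?case by (simp only: jacobi monom_eq_0)
    next
      case (2 p q)
      have "?J (monom a n) (monom b m) (p + q)
          = ?J (monom a n) (monom b m) p + ?J (monom a n) (monom b m) q"
        by (simp add: poly_bracket_add algebra_simps)
      with 2 show ?case by simp
    qed
  next
    case (2 p q)
    have "?J (monom a n) (p + q) R = ?J (monom a n) p R + ?J (monom a n) q R"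
      by (simp add: poly_bracket_add algebra_simps)
    with 2 show ?case by simp
  qed
next
  case (2 p q)
  have "?J (p + q) Q R = ?J p Q R + ?J q Q R"
    by (simp add: poly_bracket_add algebra_simps)
  with 2 show ?case by simp
qed

theorem lie_algebra_poly: "lie_algebra (poly_scale scale) (poly_bracket bracket)"
proof -
  interpret P: vector_space "poly_scale scale" by (rule vector_space_poly_scale)
  show ?thesis
    by unfold_locales
      (auto simp: poly_bracket_add poly_bracket_scale poly_bracket_self poly_bracket_jacobi)
qed

theorem lie_ideal_tensor_ideal:
  assumes "\<And>p q. p \<in> I \<Longrightarrow> q * p \<in> I"
  shows "lie_algebra.lie_ideal (poly_scale scale) (poly_bracket bracket) (tensor_ideal scale I)"
proof -
  interpret P: lie_algebra "poly_scale scale" "poly_bracket bracket" by (rule lie_algebra_poly)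
  let ?S = "{poly_tensor scale x p | x p. p \<in> I}"
  have "poly_bracket bracket Y X \<in> P.span ?S" if "X \<in> P.span ?S" for X Y
    using that
  proof (induction X rule: P.span_induct_alt)
    case base
    then show ?case by (simp add: P.span_zero)
  next
    case (step c X Z)
    then obtain x p where X: "X = poly_tensor scale x p" "p \<in> I" by blast
    have "poly_bracket bracket Y X \<in> P.span ?S"
    proof (induction Y rule: poly_monom_add_induct)
      case (1 a n)
      have "monom a n = poly_tensor scale a (monom 1 n)"
        by (rule poly_eqI) simp
      then have "poly_bracket bracket (monom a n) X = poly_tensor scale (bracket a x) (monom 1 n * p)"
        by (simp add: X poly_bracket_tensor)
      with assms X(2) show ?case by (auto intro!: P.span_base)
    next
      case (2 p q)
      then show ?case by (simp add: poly_bracket_add P.span_add)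
    qed
    with step show ?case
      by (simp add: poly_bracket_add poly_bracket_scale P.span_add P.span_scale)
  qed
  then show ?thesis
    by (simp add: P.lie_ideal_def tensor_ideal_def P.subspace_span)
qed

end


section \<open>Quotient spaces\<close>

definition quotient_space :: "'v::ab_group_add set \<Rightarrow> 'v set \<Rightarrow> 'v set set"
  where "quotient_space V W = (\<lambda>v. {v + w | w. w \<in> W}) ` V"

text \<open>
  For \<open>Q = V/W\<close>: finitely many vectors \<open>B\<close> of \<open>V\<close> have classes spanning \<open>Q\<close>, that is, every
  class in \<open>Q\<close> contains a linear combination of elements of \<open>B\<close>. The vectors in \<open>\<Union>Q = V\<close>
  are exactly the representatives of the classes in \<open>Q\<close>.
\<close>

definition finite_dim_quotient :: "('k::field \<Rightarrow> 'v::ab_group_add \<Rightarrow> 'v) \<Rightarrow> 'v set set \<Rightarrow> bool"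
  where "finite_dim_quotient scale Q \<longleftrightarrow>
    (\<exists>B. finite B \<and> B \<subseteq> \<Union>Q \<and> (\<forall>X\<in>Q. X \<inter> module.span scale B \<noteq> {}))"

lemma (in vector_space) finite_dim_quotient_iff:
  assumes "subspace V" "subspace W" "W \<subseteq> V"
  shows "finite_dim_quotient scale (quotient_space V W)
    \<longleftrightarrow> (\<exists>B. finite B \<and> B \<subseteq> V \<and> (\<forall>v\<in>V. \<exists>u\<in>span B. v - u \<in> W))"
proof -
  have U: "\<Union>(quotient_space V W) = V"
  proof
    show "\<Union>(quotient_space V W) \<subseteq> V"
      using assms by (auto simp: quotient_space_def intro: subspace_add)
    show "V \<subseteq> \<Union>(quotient_space V W)"
    proof
      fix v assume "v \<in> V"
      moreover have "v \<in> {v + w | w. w \<in> W}"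
        using subspace_0[OF assms(2)] by force
      ultimately show "v \<in> \<Union>(quotient_space V W)"
        unfolding quotient_space_def by blast
    qed
  qed
  have E: "{v + w | w. w \<in> W} \<inter> S \<noteq> {} \<longleftrightarrow> (\<exists>u\<in>S. v - u \<in> W)" for v S
  proof
    assume "{v + w | w. w \<in> W} \<inter> S \<noteq> {}"
    then obtain w where w: "w \<in> W" "v + w \<in> S" by blast
    then show "\<exists>u\<in>S. v - u \<in> W"
      using subspace_neg[OF assms(2)] by (intro bexI[of _ "v + w"]) auto
  next
    assume "\<exists>u\<in>S. v - u \<in> W"
    then obtain u where u: "u \<in> S" "v - u \<in> W" by blast
    then have "u - v \<in> W" using subspace_neg[OF assms(2), of "v - u"] by simp
    then have "u \<in> {v + w | w. w \<in> W}" by (auto intro!: exI[of _ "u - v"])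
    with u show "{v + w | w. w \<in> W} \<inter> S \<noteq> {}" by blast
  qed
  show ?thesis
    unfolding finite_dim_quotient_def U by (simp add: quotient_space_def E)
qed


section \<open>Chevalley--Eilenberg homology and cohomology with trivial coefficients\<close>

text \<open>
  Throughout, \<open>L\<close> is (the carrier of) a Lie subalgebra of a Lie algebra given by
  \<open>scale\<close> and \<open>bracket\<close>.
\<close>

definition tuples :: "nat \<Rightarrow> 'a set \<Rightarrow> 'a list set"
  where "tuples n L = {xs. length xs = n \<and> set xs \<subseteq> L}"

text \<open>\<open>contract bracket i j xs\<close> is \<open>[x\<^sub>i, x\<^sub>j], x\<^sub>0, \<dots>\<close> with the entries \<open>x\<^sub>i\<close> and \<open>x\<^sub>j\<close> left out.\<close>

definition contract :: "('a \<Rightarrow> 'a \<Rightarrow> 'a) \<Rightarrow> nat \<Rightarrow> nat \<Rightarrow> 'a list \<Rightarrow> 'a list"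
  where "contract bracket i j xs = bracket (xs ! i) (xs ! j) # nths xs (- {i, j})"

lemma contract_low_degree:
  "contract bracket 0 (Suc 0) [x, y] = [bracket x y]"
  "contract bracket 0 (Suc 0) [x, y, z] = [bracket x y, z]"
  "contract bracket 0 (Suc (Suc 0)) [x, y, z] = [bracket x z, y]"
  "contract bracket (Suc 0) (Suc (Suc 0)) [x, y, z] = [bracket y z, x]"
  by (simp_all add: contract_def nths_Cons)


subsection \<open>Homology\<close>

text \<open>
  The exterior power \<open>\<Lambda>\<^sup>n L\<close> is the free vector space on the \<open>n\<close>-tuples in \<open>L\<close> modulo
  the relations of multilinearity and alternation.
\<close>

definition chain_scale :: "'k::field \<Rightarrow> ('a \<Rightarrow>\<^sub>0 'k) \<Rightarrow> ('a \<Rightarrow>\<^sub>0 'k)"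
  where "chain_scale c u = Poly_Mapping.map ((*) c) u"

lemma lookup_chain_scale [simp]:
  "Poly_Mapping.lookup (chain_scale c u) x = c * Poly_Mapping.lookup u x"
  unfolding chain_scale_def by transfer (simp add: when_def)

lemma vector_space_chain_scale: "vector_space chain_scale"
  by unfold_locales (auto intro!: poly_mapping_eqI simp: lookup_add algebra_simps)

definition free_chains :: "nat \<Rightarrow> 'a set \<Rightarrow> ('a list \<Rightarrow>\<^sub>0 'k::field) set"
  where "free_chains n L = {u. Poly_Mapping.keys u \<subseteq> tuples n L}"

definition exterior_relations ::
    "('k::field \<Rightarrow> 'a::ab_group_add \<Rightarrow> 'a) \<Rightarrow> nat \<Rightarrow> 'a set \<Rightarrow> ('a list \<Rightarrow>\<^sub>0 'k) set"
  where "exterior_relations scale n L = module.span chain_scale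
    ({Poly_Mapping.single (us @ (x + y) # vs) 1
        - Poly_Mapping.single (us @ x # vs) 1 - Poly_Mapping.single (us @ y # vs) 1 | us x y vs.
        us @ x # vs \<in> tuples n L \<and> y \<in> L}
   \<union> {Poly_Mapping.single (us @ scale c x # vs) 1
        - chain_scale c (Poly_Mapping.single (us @ x # vs) 1) | us c x vs.
        us @ x # vs \<in> tuples n L}
   \<union> {Poly_Mapping.single xs 1 | xs. xs \<in> tuples n L \<and> \<not> distinct xs})"

definition chain_boundary ::
    "('a \<Rightarrow> 'a \<Rightarrow> 'a) \<Rightarrow> ('a list \<Rightarrow>\<^sub>0 'k::field) \<Rightarrow> ('a list \<Rightarrow>\<^sub>0 'k)"
  where "chain_boundary bracket u =
    (\<Sum>xs\<in>Poly_Mapping.keys u. \<Sum>j<length xs. \<Sum>i<j.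
       Poly_Mapping.single (contract bracket i j xs) ((-1) ^ (i + j) * Poly_Mapping.lookup u xs))"

lemma chain_boundary_low_degree:
  "chain_boundary bracket (Poly_Mapping.single [x, y] c) = - Poly_Mapping.single [bracket x y] c"
  "chain_boundary bracket (Poly_Mapping.single [x, y, z] c) =
    - Poly_Mapping.single [bracket x y, z] c + Poly_Mapping.single [bracket x z, y] c
    - Poly_Mapping.single [bracket y z, x] c"
  by (cases "c = 0"; simp add: chain_boundary_def lessThan_Suc contract_low_degree
      numeral_2_eq_2 numeral_3_eq_3 single_uminus)+

text \<open>
  Cycles and boundaries of the complex \<open>\<Lambda>\<^sup>n L\<close>, as subspaces of the free vector space that
  contain the relations. The boundary map vanishes in degree 0, so that the truncated
  \<open>n - 1\<close> imposes no condition on 0-cycles.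
\<close>

definition lie_cycles where
  "lie_cycles scale bracket n L =
    {u \<in> free_chains n L. chain_boundary bracket u \<in> exterior_relations scale (n - 1) L}"

definition lie_boundaries where
  "lie_boundaries scale bracket n L =
    {chain_boundary bracket v + r | v r.
       v \<in> free_chains (n + 1) L \<and> r \<in> exterior_relations scale n L}"

definition lie_homology ::
    "('k::field \<Rightarrow> 'a::ab_group_add \<Rightarrow> 'a) \<Rightarrow> ('a \<Rightarrow> 'a \<Rightarrow> 'a) \<Rightarrow> nat \<Rightarrow> 'a set
       \<Rightarrow> ('a list \<Rightarrow>\<^sub>0 'k) set set"
  where "lie_homology scale bracket n L =
    quotient_space (lie_cycles scale bracket n L) (lie_boundaries scale bracket n L)"


subsection \<open>Cohomology\<close>

text \<open>
  An \<open>n\<close>-cochain is an alternating \<open>n\<close>-linear map \<open>L\<^sup>n \<rightarrow> k\<close>, represented by its extension by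
  zero to all lists.
\<close>

definition cochain_scale :: "'k::field \<Rightarrow> ('b \<Rightarrow> 'k) \<Rightarrow> ('b \<Rightarrow> 'k)"
  where "cochain_scale c \<omega> = (\<lambda>xs. c * \<omega> xs)"

lemma vector_space_cochain_scale: "vector_space cochain_scale"
  by unfold_locales (auto simp: cochain_scale_def fun_eq_iff algebra_simps)

definition lie_cochains ::
    "('k::field \<Rightarrow> 'a::ab_group_add \<Rightarrow> 'a) \<Rightarrow> nat \<Rightarrow> 'a set \<Rightarrow> ('a list \<Rightarrow> 'k) set"
  where "lie_cochains scale n L = {\<omega>.
    (\<forall>xs. xs \<notin> tuples n L \<longrightarrow> \<omega> xs = 0) \<and>
    (\<forall>us x y vs. us @ x # vs \<in> tuples n L \<and> y \<in> L \<longrightarrow>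
       \<omega> (us @ (x + y) # vs) = \<omega> (us @ x # vs) + \<omega> (us @ y # vs)) \<and>
    (\<forall>us c x vs. us @ x # vs \<in> tuples n L \<longrightarrow>
       \<omega> (us @ scale c x # vs) = c * \<omega> (us @ x # vs)) \<and>
    (\<forall>xs \<in> tuples n L. \<not> distinct xs \<longrightarrow> \<omega> xs = 0)}"

text \<open>
  On an \<open>n\<close>-cochain this is supported on \<open>(n + 1)\<close>-tuples; it vanishes for \<open>n = 0\<close>, so that
  the truncated \<open>n - 1\<close> below gives no nonzero 0-coboundaries.
\<close>

definition lie_coboundary ::
    "('a \<Rightarrow> 'a \<Rightarrow> 'a) \<Rightarrow> 'a set \<Rightarrow> ('a list \<Rightarrow> 'k::field) \<Rightarrow> ('a list \<Rightarrow> 'k)"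
  where "lie_coboundary bracket L \<omega> = (\<lambda>xs.
    if set xs \<subseteq> L
    then \<Sum>j<length xs. \<Sum>i<j. (-1) ^ (i + j) * \<omega> (contract bracket i j xs)
    else 0)"

lemma lie_coboundary_low_degree:
  "{x, y} \<subseteq> L \<Longrightarrow> lie_coboundary bracket L \<omega> [x, y] = - \<omega> [bracket x y]"
  "{x, y, z} \<subseteq> L \<Longrightarrow> lie_coboundary bracket L \<omega> [x, y, z] =
    - \<omega> [bracket x y, z] + \<omega> [bracket x z, y] - \<omega> [bracket y z, x]"
  by (simp_all add: lie_coboundary_def lessThan_Suc contract_low_degree numeral_2_eq_2 numeral_3_eq_3)

definition lie_cohomology ::
    "('k::field \<Rightarrow> 'a::ab_group_add \<Rightarrow> 'a) \<Rightarrow> ('a \<Rightarrow> 'a \<Rightarrow> 'a) \<Rightarrow> nat \<Rightarrow> 'a set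
       \<Rightarrow> ('a list \<Rightarrow> 'k) set set"
  where "lie_cohomology scale bracket n L = quotient_space
    {\<omega> \<in> lie_cochains scale n L. lie_coboundary bracket L \<omega> = 0}
    (lie_coboundary bracket L ` lie_cochains scale (n - 1) L)"

end

theory Submission
  imports Defs "HOL-Computational_Algebra.Fundamental_Theorem_Algebra"
begin

text \<open>
  Multiplication by \<open>f = t\<^sup>2 + c\<^sub>1 t + c\<^sub>0\<close> identifies \<open>\<gg>[t]\<close> with \<open>\<gg> \<otimes> I\<close>, so a 2-cocycle is a family
  of bilinear forms \<open>w (x t\<^sup>i) (y t\<^sup>j)\<close> on \<open>\<gg>\<close>. By induction on \<open>m = i + j\<close>, a cocycle that vanishes for
  \<open>m \<le> 3\<close> has the form \<open>\<rho>\<^sub>m [x, y]\<close> for all \<open>m\<close>: the Jacobi identity removes the terms of lower degree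
  from the cocycle condition, which thereby becomes that of \<open>\<gg> \<otimes> t\<^sup>2\<complex>[t]\<close> in degree \<open>m\<close>.
  There, setting \<open>x = y\<close> shows that the forms for different \<open>i\<close> differ by symmetric invariant forms, and
  the nondegeneracy of the Killing form (whence derivations of \<open>\<gg>\<close> into \<open>\<gg>\<^sup>*\<close> are inner) together with
  additivity in \<open>i\<close> makes these vanish. Therefore a cocycle that vanishes on a certain finite set of
  pairs is a coboundary, and by duality both \<open>H\<^sub>2\<close> and \<open>H\<^sup>2\<close> are finite-dimensional.
\<close>

section \<open>Traces and generalized eigenspaces\<close>

text \<open>Transported to g[t], the bracket is M[P, Q] with M the multiplication by f. It sends
  degrees i, j to i + j, i + j + 1 and i + j + 2, so in general no grading is available, only the
  filtration by degree. For the same reason the functionals \<open>\<rho>\<close>, found degree by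
  degree, give a functional on g[t] only after a recurrence of order two is solved. The bound 3
  comes from the invariant parts of the forms: at fixed x, y they are scalars with s (m - i) = - s i
  and s i + s j + s k = 0 whenever i + j + k + 2 = m. For m = 3 the sequence 1, -2, 2, -1 satisfies
  this; for m >= 4 only zero does. Nondegeneracy of the Killing form is proved by contradiction:
  otherwise simplicity makes the form vanish identically, every ad x is nilpotent, and Engel's
  theorem yields a nonzero central element. The chain spaces are infinite-dimensional, so duality is
  used in one direction only: a cycle outside the span of boundaries and test tuples would be
  detected by a functional.\<close>

context finite_dimensional_vector_space
begin

definition trace_on :: "'b set \<Rightarrow> ('b \<Rightarrow> 'b) \<Rightarrow> 'a"
  where "trace_on B T = (\<Sum>b\<in>B. representation B (T b) b)"

text \<open>Expanding in both bases gives the same double sum. Two bases are allowed so that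
  \<open>T = id\<close> yields independence of the basis; traces in a basis adapted to ad x are
  later compared with traces in \<open>Basis\<close>.\<close>

lemma trace_on_comp:
  assumes B: "independent B" "span B = UNIV" and C: "independent C" "span C = UNIV"
    and S: "Vector_Spaces.linear scale scale S" and T: "Vector_Spaces.linear scale scale T"
  shows "trace_on B (S \<circ> T) = trace_on C (T \<circ> S)"
proof -
  have expand: "representation B (S (T b)) b
      = (\<Sum>c\<in>C. representation C (T b) c * representation B (S c) b)"
    if B: "independent B" "span B = UNIV" and C: "independent C" "span C = UNIV"
      and S: "Vector_Spaces.linear scale scale S" for B C S T b
  proof -
    interpret S: Vector_Spaces.linear scale scale S by (rule S)
    have "S (T b) = S (\<Sum>c\<in>C. representation C (T b) c *s c)"
      using C finiteI_independent[OF C(1)] by (simp add: sum_representation_eq)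
    also have "\<dots> = (\<Sum>c\<in>C. representation C (T b) c *s S c)"
      by (simp add: S.sum S.scale)
    finally show ?thesis
      using B by (simp add: representation_sum representation_scale)
  qed
  have "trace_on B (S \<circ> T)
      = (\<Sum>b\<in>B. \<Sum>c\<in>C. representation C (T b) c * representation B (S c) b)"
    by (simp add: trace_on_def expand[OF B C S])
  also have "\<dots> = (\<Sum>c\<in>C. \<Sum>b\<in>B. representation B (S c) b * representation C (T b) c)"
    by (subst sum.swap) (simp add: mult.commute)
  also have "\<dots> = trace_on C (T \<circ> S)"
    by (simp add: trace_on_def expand[OF C B T])
  finally show ?thesis .
qed

lemma trace_on_independent_of_basis:
  assumes "independent B" "span B = UNIV" "independent C" "span C = UNIV"
    and "Vector_Spaces.linear scale scale T"
  shows "trace_on B T = trace_on C T"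
  using trace_on_comp[OF assms linear_id] by simp

lemma trace_on_add:
  assumes "independent B" "span B = UNIV"
  shows "trace_on B (\<lambda>x. S x + T x) = trace_on B S + trace_on B T"
  using assms by (simp add: trace_on_def representation_add sum.distrib)

lemma trace_on_diff:
  assumes "independent B" "span B = UNIV"
  shows "trace_on B (\<lambda>x. S x - T x) = trace_on B S - trace_on B T"
  using assms by (simp add: trace_on_def representation_diff sum_subtractf)

lemma trace_on_scale:
  assumes "independent B" "span B = UNIV"
  shows "trace_on B (\<lambda>x. c *s T x) = c * trace_on B T"
  using assms by (simp add: trace_on_def representation_scale sum_distrib_left)

end

section \<open>Generalized eigenspaces over an arbitrary field\<close>

locale endomorphism = vector_space scale
  for scale :: "'a::field \<Rightarrow> 'b::ab_group_add \<Rightarrow> 'b" (infixr "*s" 75) +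
  fixes N :: "'b \<Rightarrow> 'b"
  assumes linear_N: "Vector_Spaces.linear scale scale N"
begin

sublocale N: Vector_Spaces.linear scale scale N
  by (rule linear_N)

definition gen_eig :: "'a \<Rightarrow> 'b set"
  where "gen_eig c = {v. \<exists>m. ((\<lambda>w. N w - c *s w) ^^ m) v = 0}"

lemma gen_eig_zero: "0 \<in> gen_eig c"
  by (auto simp: gen_eig_def intro: exI[of _ 0])

lemma gen_eig_step: "N v - c *s v \<in> gen_eig c \<Longrightarrow> v \<in> gen_eig c"
  unfolding gen_eig_def mem_Collect_eq
  by (elim exE, rule exI[of _ "Suc _"]) (simp only: funpow_Suc_right o_def)

text \<open>Induction on the nilpotency order of N - c at v, phrased without exponents.\<close>

lemma gen_eig_induct [consumes 1, case_names zero step]: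
  assumes "v \<in> gen_eig c" and "P 0"
    and "\<And>v. N v - c *s v \<in> gen_eig c \<Longrightarrow> P (N v - c *s v) \<Longrightarrow> P v"
  shows "P v"
proof -
  have "P v" if "((\<lambda>w. N w - c *s w) ^^ m) v = 0" for m
    using that
  proof (induction m arbitrary: v)
    case 0
    then show ?case using assms(2) by simp
  next
    case (Suc m)
    then have "((\<lambda>w. N w - c *s w) ^^ m) (N v - c *s v) = 0"
      by (simp only: funpow_Suc_right o_def)
    with Suc.IH assms(3) show ?case unfolding gen_eig_def by blast
  qed
  with assms(1) show ?thesis by (auto simp: gen_eig_def)
qed

lemma shift_add: "N (u + v) - c *s (u + v) = (N u - c *s u) + (N v - c *s v)"
  by (simp add: N.add scale_right_distrib)

lemma shift_scale: "N (k *s u) - c *s (k *s u) = k *s (N u - c *s u)"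
  by (simp add: N.scale scale_right_diff_distrib mult.commute)

lemma shift_commute: "N (N u - c *s u) - d *s (N u - c *s u) = N (N u - d *s u) - c *s (N u - d *s u)"
  by (simp add: N.scale N.diff scale_right_diff_distrib mult.commute)

lemma gen_eig_shift:
  assumes "v \<in> gen_eig c"
  shows "N v - c *s v \<in> gen_eig c"
proof -
  have "N 0 - c *s 0 = 0" by simp
  with assms show ?thesis
    by (induction v rule: gen_eig_induct) (metis gen_eig_zero, blast)
qed

lemma subspace_gen_eig: "subspace (gen_eig c)"
proof (rule subspaceI)
  show "u + v \<in> gen_eig c" if "u \<in> gen_eig c" "v \<in> gen_eig c" for u v
    using that
  proof (induction u arbitrary: v rule: gen_eig_induct)
    case (step u)
    then show ?case
      using gen_eig_shift shift_add by (metis gen_eig_step)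
  qed simp
  show "k *s u \<in> gen_eig c" if "u \<in> gen_eig c" for k u
    using that
  proof (induction u rule: gen_eig_induct)
    case (step u)
    then show ?case
      using shift_scale by (metis gen_eig_step)
  qed (simp add: gen_eig_zero)
qed (rule gen_eig_zero)

lemma gen_eig_shift_other:
  assumes "v \<in> gen_eig c"
  shows "N v - d *s v \<in> gen_eig c"
proof -
  have "N v - d *s v = (N v - c *s v) + (c - d) *s v"
    by (simp add: scale_left_diff_distrib)
  then show ?thesis
    using assms gen_eig_shift subspace_gen_eig subspace_add subspace_scale by metis
qed

text \<open>On \<open>gen_eig c\<close>, N - d is the nonzero scalar c - d plus the locally
  nilpotent N - c, hence invertible; the induction first solves for (N - c) u.\<close>

lemma gen_eig_shift_surj:
  assumes "u \<in> gen_eig c" "c \<noteq> d"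
  shows "\<exists>w\<in>gen_eig c. N w - d *s w = u"
  using assms(1)
proof (induction u rule: gen_eig_induct)
  case zero
  show ?case by (intro bexI[of _ 0] gen_eig_zero) simp
next
  case (step u)
  then obtain w where w: "w \<in> gen_eig c" "N w - d *s w = N u - c *s u" by blast
  have "(c - d) *s u = (N u - d *s u) - (N w - d *s w)"
    by (simp add: w(2) scale_left_diff_distrib)
  also have "\<dots> = N (u - w) - d *s (u - w)"
    using shift_add[of "u - w" w d] by simp
  finally have *: "N (u - w) - d *s (u - w) = (c - d) *s u" ..
  have "u \<in> gen_eig c" using step gen_eig_step by blast
  with w have "inverse (c - d) *s (u - w) \<in> gen_eig c"
    using subspace_gen_eig subspace_scale subspace_diff by metis
  moreover have "N (inverse (c - d) *s (u - w)) - d *s (inverse (c - d) *s (u - w)) = u"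
    unfolding shift_scale * using assms(2) by simp
  ultimately show ?case by blast
qed

lemma gen_eig_shift_inj:
  assumes "u \<in> gen_eig c" "c \<noteq> d" "N u - d *s u = 0"
  shows "u = 0"
  using assms(1,3)
proof (induction u rule: gen_eig_induct)
  case (step u)
  have "N u - c *s u = 0"
    using step shift_commute[of u c d] by simp
  with step(3) have "(c - d) *s u = 0" by (auto simp: scale_left_diff_distrib)
  with assms(2) show ?case by auto
qed simp

text \<open>Applying N - d to the relation lowers the order of the term in \<open>gen_eig d\<close>
  and keeps every other term in its space, where N - d is injective. Hence an inner induction on
  that one term.\<close>

lemma gen_eig_sum_zero:
  assumes "finite S"
    and "\<And>c. c \<in> S \<Longrightarrow> w c \<in> gen_eig c" and "(\<Sum>c\<in>S. w c) = 0" and "c \<in> S"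
  shows "w c = 0"
  using assms
proof (induction S arbitrary: w c rule: finite_induct)
  case (insert d S)
  have S: "w c = 0" if "\<And>c. c \<in> S \<Longrightarrow> w c \<in> gen_eig c" "(\<Sum>c\<in>S. w c) = 0" "c \<in> S" for w c
    using insert.IH that by blast
  have key: "v = 0" if "v \<in> gen_eig d" "\<And>c. c \<in> S \<Longrightarrow> w c \<in> gen_eig c" "v + (\<Sum>c\<in>S. w c) = 0" for v w
    using that
  proof (induction v arbitrary: w rule: gen_eig_induct)
    case (step v)
    have "(N v - d *s v) + (\<Sum>c\<in>S. N (w c) - d *s w c) = N (v + (\<Sum>c\<in>S. w c)) - d *s (v + (\<Sum>c\<in>S. w c))"
      by (simp add: N.add N.sum scale_right_distrib scale_sum_right sum_subtractf)
    then have *: "(N v - d *s v) + (\<Sum>c\<in>S. N (w c) - d *s w c) = 0"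
      using step by simp
    have G: "\<And>c. c \<in> S \<Longrightarrow> N (w c) - d *s w c \<in> gen_eig c"
      using step gen_eig_shift_other by blast
    have "N v - d *s v = 0"
      by (rule step.IH[OF G *])
    with * have "(\<Sum>c\<in>S. N (w c) - d *s w c) = 0" by simp
    then have "N (w c) - d *s w c = 0" if "c \<in> S" for c
      using S[of "\<lambda>c. N (w c) - d *s w c"] G that by blast
    then have "w c = 0" if "c \<in> S" for c
      using gen_eig_shift_inj step.prems that insert.hyps by metis
    with step.prems show ?case by simp
  qed simp
  have "w d = 0"
    using key[of "w d" w] insert by simp
  moreover from this have "(\<Sum>c\<in>S. w c) = 0"
    using insert.prems(2) insert.hyps by simp
  then have "w c = 0" if "c \<in> S"
    using that insert.prems(1) by (intro S[of w]) blast+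
  ultimately show ?case using insert.prems(3) by blast
qed simp

end

section \<open>Endomorphisms of a finite-dimensional complex space\<close>

locale complex_endomorphism = endomorphism scale N + finite_dimensional_vector_space scale Basis
  for scale :: "complex \<Rightarrow> 'b::ab_group_add \<Rightarrow> 'b" (infixr "*s" 75) and N Basis
begin

text \<open>Horner's scheme for p(N) v.\<close>

definition ev :: "complex poly \<Rightarrow> 'b \<Rightarrow> 'b"
  where "ev p v = fold_coeffs (\<lambda>a w. a *s v + N w) p 0"

lemma ev_0 [simp]: "ev 0 v = 0"
  by (simp add: ev_def)

lemma ev_pCons: "ev (pCons a p) v = a *s v + N (ev p v)"
  by (cases "a = 0 \<and> p = 0") (auto simp: ev_def)

lemma ev_add: "ev (p + q) v = ev p v + ev q v"
  by (induction p q rule: poly_induct2) (simp_all add: ev_pCons N.add scale_left_distrib algebra_simps)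

lemma ev_smult: "ev (smult c p) v = c *s ev p v"
  by (induction p) (simp_all add: ev_pCons N.scale scale_right_distrib)

lemma exists_annihilating_poly: "\<exists>p. p \<noteq> 0 \<and> ev p v = 0"
proof (rule ccontr)
  assume "\<not> ?thesis"
  then have inj: "p = 0" if "ev p v = 0" for p using that by blast
  have mon: "ev (monom c i) v = c *s (N ^^ i) v" for c i
    by (induction i) (simp_all add: monom_0 monom_Suc ev_pCons N.scale)
  have sm: "ev (sum g A) v = (\<Sum>i\<in>A. ev (g i) v)" for g :: "nat \<Rightarrow> complex poly" and A
    by (induction A rule: infinite_finite_induct) (simp_all add: ev_add)
  let ?n = "dimension"
  let ?A = "(\<lambda>i. (N ^^ i) v) ` {..?n}"
  have inj_on: "inj_on (\<lambda>i. (N ^^ i) v) {..?n}"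
  proof (rule inj_onI)
    fix i j assume "(N ^^ i) v = (N ^^ j) v"
    then have "ev (monom 1 i + smult (-1) (monom 1 j)) v = 0"
      by (simp only: ev_add ev_smult mon) simp
    from inj[OF this] have "coeff (monom (1::complex) i + smult (-1) (monom 1 j)) i = 0"
      by (simp only: coeff_0)
    then show "i = j" by (simp split: if_splits)
  qed
  have "independent ?A"
  proof (rule independent_if_scalars_zero)
    fix f x assume "(\<Sum>x\<in>?A. f x *s x) = 0" and x: "x \<in> ?A"
    then have "ev (\<Sum>i\<le>?n. monom (f ((N ^^ i) v)) i) v = 0"
      by (simp add: sum.reindex[OF inj_on] sm mon)
    from inj[OF this] have "coeff (\<Sum>i\<le>?n. monom (f ((N ^^ i) v)) i) j = 0" for j
      by simp
    from this[unfolded coeff_sum] have "f ((N ^^ j) v) = 0" if "j \<le> ?n" for j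
      using that by (simp split: if_splits) presburger
    with x show "f x = 0" by auto
  qed simp
  then have "card ?A \<le> dimension"
    using independent_card_le_dim[of ?A UNIV] by (simp add: dimension_def)
  then show False
    by (simp add: card_image[OF inj_on])
qed

text \<open>U is not assumed invariant, so no quotient endomorphism is available. Instead w = q(N)
  v, where (t - c) q is a nonzero polynomial of least degree that sends v into U.\<close>

lemma exists_eigenvector_modulo:
  assumes U: "subspace U" "v \<notin> U"
  shows "\<exists>w c. w \<notin> U \<and> N w - c *s w \<in> U"
proof -
  note ev = ev_pCons ev_add ev_smult
  define P where "P p \<longleftrightarrow> p \<noteq> 0 \<and> ev p v \<in> U" for p
  obtain p0 where "P p0"
    using exists_annihilating_poly[of v] subspace_0[OF U(1)] unfolding P_def by metis
  then obtain p where p: "P p" and min: "\<And>q. P q \<Longrightarrow> degree p \<le> degree q"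
    using ex_has_least_nat[of P p0 degree] by blast
  have "degree p > 0"
  proof (rule ccontr)
    assume "\<not> degree p > 0"
    then obtain a where "p = [:a:]" using degree_0_id[of p] by (metis gr0I)
    with p have a: "a \<noteq> 0" "a *s v \<in> U"
      by (auto simp: P_def ev)
    then have "inverse a *s (a *s v) \<in> U" using U subspace_scale by blast
    with a U show False by simp
  qed
  then have "\<not> constant (poly p)" by (simp add: constant_degree)
  then obtain c where "poly p c = 0" using fundamental_theorem_of_algebra by blast
  then obtain q where q: "p = [:- c, 1:] * q" by (auto simp: poly_eq_0_iff_dvd dvd_def)
  have "q \<noteq> 0" using p q by (auto simp: P_def)
  then have "degree p = degree [:- c, 1:] + degree q"
    unfolding q by (intro degree_mult_eq) simp_all
  then have "degree q < degree p" by simp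
  with min \<open>q \<noteq> 0\<close> have "ev q v \<notin> U" by (force simp: P_def)
  moreover have "p = smult (- c) q + pCons 0 q"
    by (simp add: q)
  then have "ev p v = N (ev q v) - c *s ev q v"
    by (simp only: ev) simp
  ultimately show ?thesis using p by (auto simp: P_def)
qed

text \<open>If the sum U of the spaces is proper, take w outside U with (N - c) w in U. Components
  for d other than c lie in the image of N - c, so some y in U makes (N - c)(y - w) lie in
  \<open>gen_eig c\<close>. Then y - w lies there too, which puts w in U.\<close>

lemma span_gen_eig:
  shows "span (\<Union>c. gen_eig c) = UNIV"
proof (rule ccontr)
  let ?U = "span (\<Union>c. gen_eig c)"
  assume "?U \<noteq> UNIV"
  then obtain v where "v \<notin> ?U" by blast
  then obtain w c where w: "w \<notin> ?U" "N w - c *s w \<in> ?U"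
    using exists_eigenvector_modulo[OF subspace_span] by blast
  have "\<exists>y\<in>?U. (N y - c *s y) - u \<in> gen_eig c" if "u \<in> ?U" for u
    using that
  proof (induction u rule: span_induct_alt)
    case base
    show ?case by (intro bexI[of _ 0]) (simp_all add: gen_eig_zero span_zero)
  next
    case (step k x u)
    then obtain y where y: "y \<in> ?U" "(N y - c *s y) - u \<in> gen_eig c" by blast
    from step obtain d where d: "x \<in> gen_eig d" by blast
    show ?case
    proof (cases "d = c")
      case True
      with d y have "(N y - c *s y) - u - k *s x \<in> gen_eig c"
        using subspace_gen_eig subspace_diff subspace_scale by metis
      with y show ?thesis by (auto intro!: bexI[of _ y] simp: algebra_simps)
    next
      case False
      then obtain z where z: "z \<in> gen_eig d" "N z - c *s z = x"
        using gen_eig_shift_surj[OF d] by blast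
      have "N (k *s z + y) - c *s (k *s z + y) - (k *s x + u) = N y - c *s y - u"
        unfolding shift_add shift_scale z(2) by simp
      moreover have "k *s z + y \<in> ?U"
        using z y by (intro span_add span_scale) (auto intro: span_base)
      ultimately show ?thesis using y by metis
    qed
  qed
  with w(2) obtain y where y: "y \<in> ?U" "(N y - c *s y) - (N w - c *s w) \<in> gen_eig c" by blast
  have "(N y - c *s y) - (N w - c *s w) = N (y - w) - c *s (y - w)"
    using shift_add[of "y - w" w c] by simp
  with y have "y - w \<in> gen_eig c" using gen_eig_step by metis
  then have "y - w \<in> ?U" by (auto intro: span_base)
  with y have "w \<in> ?U" using span_diff[of y _ "y - w"] by simp
  with w show False by blast
qed

text \<open>Only the diagonal coefficient of N at b is recorded, which is all that a trace sees. A
  maximal independent set of this kind spans every \<open>gen_eig c\<close>: a vector v outside the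
  span with (N - c) v inside it could be added.\<close>

lemma triangular_gen_eig_basis:
  obtains B l where "independent B" "span B = UNIV"
    "\<And>b. b \<in> B \<Longrightarrow> b \<in> gen_eig (l b)"
    "\<And>b. b \<in> B \<Longrightarrow> N b - l b *s b \<in> span (B - {b})"
proof -
  define P where "P B \<longleftrightarrow> independent B \<and>
    (\<forall>b\<in>B. \<exists>c. b \<in> gen_eig c \<and> N b - c *s b \<in> span (B - {b}))" for B
  have P0: "P {}" by (simp add: P_def independent_empty)
  have bound: "card B \<le> dimension" if "P B" for B
    using that independent_card_le_dim[of B UNIV] by (simp add: P_def dimension_def)
  obtain B where B: "P B" and max: "\<And>C. P C \<Longrightarrow> card C \<le> card B"
    using ex_has_greatest_nat[of P "{}" card "Suc dimension"] P0 bound by (auto simp: le_imp_less_Suc)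
  have fin: "finite B" using B finiteI_independent by (simp add: P_def)
  have "gen_eig c \<subseteq> span B" for c
  proof
    fix v assume "v \<in> gen_eig c"
    then show "v \<in> span B"
    proof (induction v rule: gen_eig_induct)
      case (step v)
      show ?case
      proof (rule ccontr)
        assume v: "v \<notin> span B"
        have "P (insert v B)"
          unfolding P_def
        proof (intro conjI ballI)
          show "independent (insert v B)" using v B by (simp add: P_def independent_insertI)
        next
          fix b assume b: "b \<in> insert v B"
          show "\<exists>c. b \<in> gen_eig c \<and> N b - c *s b \<in> span (insert v B - {b})"
          proof (cases "b = v")
            case True
            moreover have "B \<subseteq> insert v B - {v}" using v span_base by blast
            ultimately show ?thesis using step gen_eig_step span_mono by blast
          next
            case False
            with b B obtain c where "b \<in> gen_eig c" "N b - c *s b \<in> span (B - {b})"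
              by (auto simp: P_def)
            then show ?thesis using span_mono[of "B - {b}" "insert v B - {b}"] by blast
          qed
        qed
        from max[OF this] have "card (insert v B) \<le> card B" .
        moreover have "v \<notin> B" using v span_base by blast
        ultimately show False using fin by simp
      qed
    qed (rule span_zero)
  qed
  then have "span (\<Union>c. gen_eig c) \<subseteq> span B"
    by (intro span_minimal) auto
  then have span: "span B = UNIV"
    using span_gen_eig by blast
  obtain l where "\<forall>b\<in>B. b \<in> gen_eig (l b) \<and> N b - l b *s b \<in> span (B - {b})"
    using B unfolding P_def by metis
  with that[of B l] B span show ?thesis by (auto simp: P_def)
qed

end

section \<open>Nondegeneracy of the Killing form\<close>

locale fd_lie_algebra = lie_algebra scale bracket + finite_dimensional_vector_space scale Basis
  for scale :: "complex \<Rightarrow> 'g::ab_group_add \<Rightarrow> 'g" (infixr "*s" 75) and bracket Basis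
begin

abbreviation tr :: "('g \<Rightarrow> 'g) \<Rightarrow> complex"
  where "tr \<equiv> trace_on Basis"

abbreviation lin :: "('g \<Rightarrow> 'g) \<Rightarrow> bool"
  where "lin \<equiv> Vector_Spaces.linear scale scale"

definition killing :: "'g \<Rightarrow> 'g \<Rightarrow> complex"
  where "killing x y = tr (bracket x \<circ> bracket y)"

definition derivation :: "('g \<Rightarrow> 'g) \<Rightarrow> bool"
  where "derivation E \<longleftrightarrow> lin E \<and> (\<forall>x y. E (bracket x y) = bracket (E x) y + bracket x (E y))"

lemma lin_ad: "lin (bracket x)"
  by (rule bracket_linear_right)

lemma lin_comp: "lin S \<Longrightarrow> lin T \<Longrightarrow> lin (S \<circ> T)"
  by (rule Vector_Spaces.linear_compose)

lemma bracket_bracket: "bracket (bracket x y) z = bracket x (bracket y z) - bracket y (bracket x z)"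
proof -
  have "bracket z (bracket x y) = - bracket (bracket x y) z" "bracket z x = - bracket x z"
    by (rule bracket_anticomm)+
  moreover have "bracket y (- bracket x z) = - bracket y (bracket x z)"
    using bracket_scale_right[of y "-1" "bracket x z"] by simp
  ultimately show ?thesis using jacobi[of x y z] by (simp add: algebra_simps)
qed

lemma bracket_diff: "bracket (x - y) z = bracket x z - bracket y z" "bracket z (x - y) = bracket z x - bracket z y"
  by (metis bracket_add_left diff_add_cancel eq_diff_eq, metis bracket_add_right diff_add_cancel eq_diff_eq)

lemma tr_comm: "lin S \<Longrightarrow> lin T \<Longrightarrow> tr (S \<circ> T) = tr (T \<circ> S)"
  by (rule trace_on_comp[OF independent_Basis span_Basis independent_Basis span_Basis])

lemmas tr_diff = trace_on_diff[OF independent_Basis span_Basis]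
lemmas tr_add = trace_on_add[OF independent_Basis span_Basis]
lemmas tr_scale = trace_on_scale[OF independent_Basis span_Basis]

lemma killing_add: "killing (x + y) z = killing x z + killing y z" "killing z (x + y) = killing z x + killing z y"
  by (simp_all add: killing_def o_def bracket_add_left bracket_add_right tr_add)

lemma killing_scale: "killing (c *s x) z = c * killing x z" "killing z (c *s x) = c * killing z x"
  by (simp_all add: killing_def o_def bracket_scale_left bracket_scale_right tr_scale)

lemma killing_commute: "killing x y = killing y x"
  by (simp add: killing_def tr_comm[OF lin_ad lin_ad])

text \<open>From ad (E x) = E ad x - ad x E and cyclicity of the trace. With E inner this is
  invariance of the Killing form; for general E it shows that \<open>killing (E x) y\<close> depends
  on the bracket of x and y alone.\<close>

lemma killing_derivation:
  assumes "derivation E"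
  shows "killing (E x) y = tr (E \<circ> bracket (bracket x y))"
proof -
  have E: "lin E" using assms by (simp add: derivation_def)
  interpret E: Vector_Spaces.linear scale scale E by (rule E)
  have ad: "bracket (E x) z = E (bracket x z) - bracket x (E z)" for z
    using assms by (simp add: derivation_def)
  have "killing (E x) y = tr (\<lambda>z. (E \<circ> bracket x \<circ> bracket y) z - (bracket x \<circ> (E \<circ> bracket y)) z)"
    by (simp add: killing_def ad o_def)
  also have "\<dots> = tr (E \<circ> bracket x \<circ> bracket y) - tr (E \<circ> bracket y \<circ> bracket x)"
    using tr_comm[OF lin_ad[of x] lin_comp[OF E lin_ad[of y]]] by (simp add: tr_diff o_def)
  also have "\<dots> = tr (\<lambda>z. (E \<circ> bracket x \<circ> bracket y) z - (E \<circ> bracket y \<circ> bracket x) z)"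
    by (simp add: tr_diff o_def)
  also have "\<dots> = tr (E \<circ> bracket (bracket x y))"
    by (simp add: o_def bracket_bracket E.diff)
  finally show ?thesis .
qed

lemma derivation_ad: "derivation (bracket x)"
  using lin_ad by (simp add: derivation_def bracket_bracket algebra_simps)

lemma killing_invariant: "killing (bracket x y) z = killing x (bracket y z)"
proof -
  have "killing (bracket x y) z = tr (bracket x \<circ> bracket (bracket y z))"
    by (rule killing_derivation[OF derivation_ad])
  then show ?thesis by (simp add: killing_def)
qed

text \<open>Let \<open>D\<close> act on the generalized eigenspace of \<open>ad x\<close> for \<open>l\<close> as the scalar \<open>cnj l\<close>. Then \<open>D\<close> is a
  derivation, so \<open>tr (ad [a, b] \<circ> D)\<close> is minus the Killing form at \<open>a\<close> and \<open>D b\<close>, whereas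
  \<open>tr (ad x \<circ> D)\<close> is the sum of the \<open>\<bar>l\<bar>\<^sup>2\<close>.\<close>

lemma ad_nilpotent_of_killing_zero:
  assumes killing0: "\<And>x y. killing x y = 0" and x: "x \<in> span {bracket a b | a b. True}"
  shows "\<exists>m. (bracket x ^^ m) v = 0"
proof -
  interpret N: complex_endomorphism scale "bracket x" Basis
    by unfold_locales (simp_all add: bracket_add_right bracket_scale_right)
  obtain B l where B: "independent B" "span B = UNIV"
    and eig: "\<And>b. b \<in> B \<Longrightarrow> b \<in> N.gen_eig (l b)"
    and tri: "\<And>b. b \<in> B \<Longrightarrow> bracket x b - l b *s b \<in> span (B - {b})"
    using N.triangular_gen_eig_basis by blast
  have fin: "finite B" using B finiteI_independent by blast
  define D where "D v = (\<Sum>b\<in>B. (representation B v b * cnj (l b)) *s b)" for v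
  have D: "lin D"
    unfolding Vector_Spaces.linear_iff
    using B vector_space_axioms
    by (simp add: D_def representation_add representation_scale distrib_right
        scale_left_distrib sum.distrib scale_sum_right mult.assoc)
  interpret D: Vector_Spaces.linear scale scale D by (rule D)
  have rep: "(\<Sum>b\<in>B. representation B v b *s b) = v" for v
    using B fin by (simp add: sum_representation_eq)
  have D_eig: "D u = cnj c *s u" if u: "u \<in> N.gen_eig c" for u c
  proof -
    let ?r = "representation B u"
    \<comment> \<open>Below, \<open>w d\<close> is the component of u for d, minus u itself when d =
      c. These sum to zero, so independence kills the components other than c. The value c is
      inserted because it may not occur among the l b.\<close>
    let ?S = "insert c (l ` B)"
    define w where "w d = (\<Sum>b | b \<in> B \<and> l b = d. ?r b *s b) - (if d = c then u else 0)" for d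
    have "(\<Sum>d\<in>?S. \<Sum>b | b \<in> B \<and> l b = d. ?r b *s b) = (\<Sum>b\<in>B. ?r b *s b)"
      by (rule sum.group) (use fin in auto)
    then have "(\<Sum>d\<in>?S. w d) = 0"
      using fin by (simp add: w_def sum_subtractf rep)
    moreover have "w d \<in> N.gen_eig d" for d
      unfolding w_def
    proof (intro subspace_diff[OF N.subspace_gen_eig] subspace_sum[OF N.subspace_gen_eig]
        subspace_scale[OF N.subspace_gen_eig])
      show "(if d = c then u else 0) \<in> N.gen_eig d" using u N.gen_eig_zero by simp
    qed (use eig in auto)
    ultimately have w0: "w d = 0" if "d \<in> ?S" for d
      using N.gen_eig_sum_zero[of ?S w d] that fin by blast
    have "?r b = 0" if b: "b \<in> B" "l b \<noteq> c" for b
    proof -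
      have "(\<Sum>b' | b' \<in> B \<and> l b' = l b. ?r b' *s b') = 0"
        using w0[of "l b"] b by (simp add: w_def)
      then show ?thesis
        using independentD[OF B(1), of "{b'. b' \<in> B \<and> l b' = l b}" ?r b] b fin by auto
    qed
    then have "D u = (\<Sum>b\<in>B. cnj c *s (?r b *s b))"
      unfolding D_def by (intro sum.cong refl) (auto simp: mult.commute)
    then show ?thesis by (simp only: scale_sum_right[symmetric] rep)
  qed
  \<comment> \<open>With N = ad x, N - (c + d) sends [u, v] to [(N - c) u, v] + [u, (N - d) v];
    hence a double induction on the orders of u and v.\<close>
  have leibniz: "bracket u v \<in> N.gen_eig (c + d)" if "u \<in> N.gen_eig c" "v \<in> N.gen_eig d" for u v c d
    using that
  proof (induction u arbitrary: v rule: N.gen_eig_induct)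
    case zero
    then show ?case by (simp add: N.gen_eig_zero)
  next
    case (step u)
    from step.prems show ?case
    proof (induction v rule: N.gen_eig_induct)
      case zero
      then show ?case by (simp add: N.gen_eig_zero)
    next
      case inner: (step v)
      have "bracket (bracket x u - c *s u) v + bracket u (bracket x v - d *s v)
          = bracket x (bracket u v) - (c + d) *s bracket u v"
        by (simp add: bracket_diff bracket_scale_left bracket_scale_right bracket_bracket
            scale_left_distrib algebra_simps)
      moreover have "bracket (bracket x u - c *s u) v \<in> N.gen_eig (c + d)"
        using step.IH inner.hyps N.gen_eig_step by blast
      ultimately show ?case
        using inner N.gen_eig_step N.subspace_gen_eig subspace_add by metis
    qed
  qed
  have der: "D (bracket u v) = bracket (D u) v + bracket u (D v)" for u v
  proof -
    have "u \<in> span B" "v \<in> span B" using B by simp_all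
    then show ?thesis
    proof (induction u rule: span_induct_alt)
      case (step k b u)
      have "v \<in> span B" using B by simp
      then have "D (bracket b v) = bracket (D b) v + bracket b (D v)"
      proof (induction v rule: span_induct_alt)
        case (step k c v)
        \<comment> \<open>Additivity of conjugation is what makes D a derivation.\<close>
        have "D (bracket b c) = cnj (l b + l c) *s bracket b c"
          by (intro D_eig leibniz eig step \<open>b \<in> B\<close>)
        then have "D (bracket b c) = bracket (D b) c + bracket b (D c)"
          using D_eig[OF eig] step \<open>b \<in> B\<close>
          by (simp add: bracket_scale_left bracket_scale_right scale_left_distrib)
        with step show ?case
          by (simp add: bracket_add_right bracket_scale_right D.add D.scale scale_right_distrib algebra_simps)
      qed simp
      with step show ?case
        by (simp add: bracket_add_left bracket_scale_left D.add D.scale scale_right_distrib algebra_simps)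
    qed simp
  qed
  have "trace_on B (bracket y \<circ> D) = 0" if "y \<in> span {bracket a b | a b. True}" for y
    using that
  proof (induction y rule: span_induct_alt)
    case base
    show ?case using B by (simp add: trace_on_def representation_zero)
  next
    case (step c z y)
    then obtain a b where z: "z = bracket a b" by blast
    have "trace_on B (bracket b \<circ> (bracket a \<circ> D)) = trace_on B (bracket a \<circ> (D \<circ> bracket b))"
      using trace_on_comp[OF B B lin_ad lin_comp[OF lin_ad D]] by (simp add: o_assoc)
    then have "trace_on B (bracket z \<circ> D)
        = trace_on B (bracket a \<circ> (bracket b \<circ> D)) - trace_on B (bracket a \<circ> (D \<circ> bracket b))"
      using trace_on_diff[OF B, of "bracket a \<circ> (bracket b \<circ> D)" "bracket b \<circ> (bracket a \<circ> D)"]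
      by (simp add: z o_def bracket_bracket)
    also have "\<dots> = trace_on B (\<lambda>v. bracket a (bracket b (D v)) - bracket a (D (bracket b v)))"
      using trace_on_diff[OF B, of "bracket a \<circ> (bracket b \<circ> D)" "bracket a \<circ> (D \<circ> bracket b)"]
      by (simp add: o_def)
    also have "\<dots> = trace_on B (\<lambda>v. (-1) *s (bracket a \<circ> bracket (D b)) v)"
      by (simp add: der bracket_add_right o_def)
    also have "\<dots> = - trace_on B (bracket a \<circ> bracket (D b))"
      using trace_on_scale[OF B, of "-1" "bracket a \<circ> bracket (D b)"] by (simp add: o_def)
    also have "trace_on B (bracket a \<circ> bracket (D b)) = killing a (D b)"
      unfolding killing_def
      by (rule trace_on_independent_of_basis[OF B independent_Basis span_Basis lin_comp[OF lin_ad lin_ad]])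
    finally have "trace_on B (bracket z \<circ> D) = 0" by (simp add: killing0 o_def)
    moreover have "trace_on B (bracket (c *s z + y) \<circ> D)
        = c * trace_on B (bracket z \<circ> D) + trace_on B (bracket y \<circ> D)"
      using trace_on_add[OF B, of "\<lambda>v. c *s (bracket z \<circ> D) v" "bracket y \<circ> D"]
        trace_on_scale[OF B, of c "bracket z \<circ> D"]
      by (simp add: o_def bracket_add_left bracket_scale_left)
    ultimately show ?case using step by (simp add: o_def)
  qed
  then have "trace_on B (bracket x \<circ> D) = 0" using x .
  moreover have "representation B (bracket x (D b)) b = complex_of_real ((cmod (l b))\<^sup>2)" if b: "b \<in> B" for b
  proof -
    define r where "r = bracket x b - l b *s b"
    have "representation B r b = representation (B - {b}) r b"
      using representation_extend[OF B(1), of r "B - {b}"] tri[OF b] by (simp add: r_def)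
    also have "\<dots> = 0" using representation_ne_zero by blast
    finally have "representation B r b = 0" .
    moreover have "bracket x b = l b *s b + r" by (simp add: r_def)
    ultimately have "representation B (bracket x b) b = l b"
      using B b by (simp add: representation_add representation_scale representation_basis)
    then show ?thesis
      using D_eig[OF eig[OF b]] B
      by (simp add: bracket_scale_right representation_scale mult.commute flip: complex_norm_square)
  qed
  ultimately have "complex_of_real (\<Sum>b\<in>B. (cmod (l b))\<^sup>2) = 0"
    by (simp add: trace_on_def)
  then have "(\<Sum>b\<in>B. (cmod (l b))\<^sup>2) = 0" by (simp only: of_real_eq_0_iff)
  then have "l b = 0" if "b \<in> B" for b
    using that fin by (simp add: sum_nonneg_eq_0_iff)
  with eig have "B \<subseteq> N.gen_eig 0" by auto
  then have "span B \<subseteq> N.gen_eig 0" using N.subspace_gen_eig by (rule span_minimal)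
  with B have "v \<in> N.gen_eig 0" by auto
  then show ?thesis by (simp add: N.gen_eig_def)
qed

text \<open>\<open>nil_on K v\<close>: every sequence of brackets with elements of \<open>K\<close> eventually kills \<open>v\<close>.\<close>

inductive nil_on :: "'g set \<Rightarrow> 'g \<Rightarrow> bool" for K
  where zero: "nil_on K 0"
  | step: "(\<And>k. k \<in> K \<Longrightarrow> nil_on K (bracket k v)) \<Longrightarrow> nil_on K v"

lemma nil_on_bracket: "nil_on K v \<Longrightarrow> k \<in> K \<Longrightarrow> nil_on K (bracket k v)"
  by (erule nil_on.cases) (auto intro: nil_on.zero)

lemma nil_on_add: "nil_on K u \<Longrightarrow> nil_on K v \<Longrightarrow> nil_on K (u + v)"
proof (induction u arbitrary: v rule: nil_on.induct)
  case (step u)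
  show ?case
    by (rule nil_on.step) (use step nil_on_bracket in \<open>simp add: bracket_add_right\<close>)
qed simp

lemma nil_on_scale: "nil_on K v \<Longrightarrow> nil_on K (c *s v)"
proof (induction v rule: nil_on.induct)
  case (step v)
  show ?case
    by (rule nil_on.step) (use step in \<open>simp add: bracket_scale_right\<close>)
qed (simp add: nil_on.zero)

text \<open>As x normalizes K, a bracket of k in K with (ad x)^m v is a combination of vectors (ad
  x)^j [k', v] with k' in K, covered by induction on v. Brackets with x raise m, and some power of
  ad x kills v, so m is treated in descending order.\<close>

lemma nil_on_insert:
  assumes K: "\<And>k. k \<in> K \<Longrightarrow> bracket x k \<in> K"
    and x: "\<And>v. \<exists>m. (bracket x ^^ m) v = 0" and v: "nil_on K v"
  shows "nil_on (span (insert x K)) v"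
proof -
  let ?K = "span (insert x K)"
  have minus: "nil_on ?K (- w)" if "nil_on ?K w" for w
    using nil_on_scale[OF that, of "-1"] by simp
  have "nil_on ?K ((bracket x ^^ m) v)" for m
    using v
  proof (induction v arbitrary: m rule: nil_on.induct)
    case zero
    have "(bracket x ^^ m) 0 = 0" by (induction m) simp_all
    then show ?case by (simp add: nil_on.zero)
  next
    case (step v)
    have word: "nil_on ?K ((bracket x ^^ j) (bracket k ((bracket x ^^ m) v)))" if "k \<in> K" for j k m
      using that
    proof (induction m arbitrary: j k)
      case 0
      then show ?case using step by simp
    next
      case (Suc m)
      let ?w = "(bracket x ^^ m) v"
      have "bracket k (bracket x ?w) = bracket x (bracket k ?w) + - bracket (bracket x k) ?w"
        by (simp add: bracket_bracket)
      moreover have "(bracket x ^^ j) (a + - b) = (bracket x ^^ j) a + - (bracket x ^^ j) b" for a b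
        by (induction j arbitrary: a b) (simp_all add: bracket_diff)
      moreover have "nil_on ?K ((bracket x ^^ j) (bracket x (bracket k ?w)))"
        using Suc.IH[OF Suc.prems, of "Suc j"] by (simp only: funpow_Suc_right o_def)
      ultimately show ?case
        using Suc.IH[OF K[OF Suc.prems]] by (simp add: nil_on_add minus del: add_uminus_conv_diff)
    qed
    obtain n where n: "(bracket x ^^ n) v = 0" using x by blast
    \<comment> \<open>The exponent descends from n + i, where the vector is zero, to i, reached at
      i' = n.\<close>
    have "nil_on ?K ((bracket x ^^ (n + i - i')) v)" if "i' \<le> n + i" for i i'
      using that
    proof (induction i')
      case 0
      have "(bracket x ^^ i) ((bracket x ^^ n) v) = 0" unfolding n by (induction i) simp_all
      then show ?case by (metis add.commute diff_zero funpow_add nil_on.zero o_apply)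
    next
      case (Suc i')
      let ?m = "n + i - Suc i'"
      have "n + i - i' = Suc ?m" using Suc.prems by simp
      with Suc have IH: "nil_on ?K (bracket x ((bracket x ^^ ?m) v))" by simp
      show ?case
      proof (rule nil_on.step)
        fix k assume "k \<in> ?K"
        then show "nil_on ?K (bracket k ((bracket x ^^ ?m) v))"
        proof (induction k rule: span_induct_alt)
          case (step c k y)
          have "nil_on ?K (bracket k ((bracket x ^^ ?m) v))"
            using step IH word[of k 0 ?m] by auto
          with step show ?case
            by (simp add: bracket_add_left bracket_scale_left nil_on_add nil_on_scale)
        qed (simp add: nil_on.zero)
      qed
    qed
    from this[of n m] show ?case by simp
  qed
  from this[of 0] show ?thesis by simp
qed

text \<open>Take a subalgebra K of largest dimension acting by \<open>nil_on\<close>. If K is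
  proper, taking brackets with K from a vector outside K ends at a last vector x outside K. This x
  normalizes K, so K can be enlarged by x.\<close>

lemma engel:
  assumes nilpotent: "\<And>x v. \<exists>m. (bracket x ^^ m) v = 0"
  shows "nil_on UNIV v"
proof -
  define P where "P K \<longleftrightarrow> subspace K \<and> (\<forall>x\<in>K. \<forall>y\<in>K. bracket x y \<in> K) \<and> (\<forall>v. nil_on K v)" for K
  have "nil_on {0} v" for v by (rule nil_on.step) (simp add: nil_on.zero)
  then have P0: "P {0}" by (simp add: P_def)
  obtain K where K: "P K" and max: "\<And>K'. P K' \<Longrightarrow> dim K' \<le> dim K"
    using ex_has_greatest_nat[of P "{0}" dim "Suc dimension"] P0 dim_subset_UNIV
    by (auto simp: le_imp_less_Suc)
  have "K = UNIV"
  proof (rule ccontr)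
    assume "K \<noteq> UNIV"
    then obtain v where "v \<notin> K" by blast
    moreover have "nil_on K v" using K by (simp add: P_def)
    moreover have "\<exists>x. x \<notin> K \<and> (\<forall>k\<in>K. bracket k x \<in> K)" if "nil_on K v" "v \<notin> K" for v
      using that
    proof (induction v rule: nil_on.induct)
      case zero
      then show ?case using K subspace_0 by (auto simp: P_def)
    qed blast
    ultimately obtain x where x: "x \<notin> K" and xk: "\<And>k. k \<in> K \<Longrightarrow> bracket k x \<in> K" by blast
    have sub: "subspace K" using K by (simp add: P_def)
    have kx: "bracket x k \<in> K" if "k \<in> K" for k
      using subspace_neg[OF sub xk[OF that]] bracket_anticomm[of x k] by simp
    let ?K = "span (insert x K)"
    have le: "K \<subseteq> ?K" using span_superset by blast
    \<comment> \<open>As [x, x] = 0 and x normalizes K, brackets of the larger space even land in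
      K.\<close>
    have "bracket u v \<in> K" if uv: "u \<in> ?K" "v \<in> ?K" for u v
    proof -
      obtain c d where "u - c *s x \<in> K" "v - d *s x \<in> K"
        using uv span_eq_iff[THEN iffD2, OF sub] by (auto simp: span_breakdown_eq)
      then obtain k k' where "u = k + c *s x" "k \<in> K" "v = k' + d *s x" "k' \<in> K"
        by (metis diff_add_cancel)
      with K sub show ?thesis
        by (auto simp: P_def bracket_add_left bracket_add_right bracket_scale_left bracket_scale_right
            bracket_self xk kx intro!: subspace_add[OF sub] subspace_scale[OF sub])
    qed
    moreover have "nil_on ?K v" for v
      using nil_on_insert[OF kx nilpotent] K by (simp add: P_def)
    ultimately have "P ?K" using le by (auto simp: P_def)
    from subspace_dim_equal[OF sub subspace_span le max[OF this]] x
    show False using span_base by blast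
  qed
  with K show ?thesis by (simp add: P_def)
qed

end

section \<open>Simplicity and the Killing form\<close>

locale fd_simple_lie_algebra = fd_lie_algebra scale bracket Basis + simple_lie_algebra scale bracket
  for scale :: "complex \<Rightarrow> 'g::ab_group_add \<Rightarrow> 'g" (infixr "*s" 75) and bracket Basis
begin

lemma perfect: "span {bracket a b | a b. True} = UNIV"
proof -
  let ?S = "{bracket a b | a b. True}"
  have "bracket x y \<in> span ?S" for x y by (rule span_base) blast
  then have "lie_ideal (span ?S)" by (simp add: lie_ideal_def)
  moreover obtain x y where "bracket x y \<noteq> 0" using nonabelian by blast
  then have "span ?S \<noteq> {0}" using span_base[of "bracket x y" ?S] by auto
  ultimately show ?thesis using ideal_trivial by blast
qed

lemma center_trivial:
  assumes "\<And>x. bracket x z = 0"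
  shows "z = 0"
proof (rule ccontr)
  assume "z \<noteq> 0"
  let ?Z = "{z. \<forall>x. bracket x z = 0}"
  have "lie_ideal ?Z"
    by (auto simp: lie_ideal_def bracket_add_right bracket_scale_right intro!: subspaceI)
  with assms \<open>z \<noteq> 0\<close> have "?Z = UNIV" using ideal_trivial[of ?Z] by auto
  then show False using nonabelian by blast
qed

theorem killing_nondegenerate:
  assumes "\<And>y. killing x y = 0"
  shows "x = 0"
proof (rule ccontr)
  assume "x \<noteq> 0"
  let ?R = "{x. \<forall>y. killing x y = 0}"
  have "killing (bracket a b) y = 0" if "b \<in> ?R" for a b y
  proof -
    have "killing (bracket a b) y = killing (bracket y a) b"
      using killing_commute killing_invariant by metis
    with that killing_commute[of "bracket y a" b] show ?thesis by simp
  qed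
  then have "lie_ideal ?R"
    by (auto simp: lie_ideal_def killing_add killing_scale killing_def[of 0] trace_on_def o_def
        representation_zero intro!: subspaceI)
  with assms \<open>x \<noteq> 0\<close> have "?R = UNIV" using ideal_trivial[of ?R] by auto
  then have "killing x y = 0" for x y by blast
  then have "nil_on UNIV v" for v
    using engel ad_nilpotent_of_killing_zero perfect by blast
  \<comment> \<open>The last nonzero vector in a chain of brackets starting at v is central.\<close>
  moreover have "\<exists>z. z \<noteq> 0 \<and> (\<forall>x. bracket x z = 0)" if "nil_on UNIV v" "v \<noteq> 0" for v
    using that by (induction v rule: nil_on.induct) blast+
  ultimately show False using center_trivial \<open>x \<noteq> 0\<close> by blast
qed

lemma killing_represent:
  assumes "Vector_Spaces.linear scale (*) l"
  shows "\<exists>u. \<forall>y. killing u y = l y"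
proof -
  interpret l: Vector_Spaces.linear scale "(*)" l by (rule assms)
  \<comment> \<open>A functional is encoded as the vector whose coordinates are its values on
    \<open>Basis\<close>. This makes \<open>\<Phi>\<close> an endomorphism, for which injectivity
    implies surjectivity.\<close>
  define \<Phi> where "\<Phi> u = (\<Sum>b\<in>Basis. killing u b *s b)" for u
  have lin: "lin \<Phi>"
    unfolding Vector_Spaces.linear_iff using vector_space_axioms
    by (simp add: \<Phi>_def killing_add killing_scale scale_left_distrib sum.distrib scale_sum_right)
  have on_basis: "killing u y = k y"
    if "\<And>b. b \<in> Basis \<Longrightarrow> killing u b = k b" "Vector_Spaces.linear scale (*) k" for u y and k
  proof -
    interpret k: Vector_Spaces.linear scale "(*)" k by (rule that)
    have "y \<in> span Basis" by (simp add: span_Basis)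
    then show ?thesis
    proof (induction y rule: span_induct_alt)
      case base
      have "killing u 0 = 0" using killing_scale(2)[where c = 0 and x = 0 and z = u] by simp
      then show ?case by simp
    next
      case (step c x y)
      then show ?case by (simp add: killing_add killing_scale k.add k.scale that)
    qed
  qed
  interpret \<Phi>: Vector_Spaces.linear scale scale \<Phi> by (rule lin)
  have coord: "c b = d b" if "(\<Sum>b\<in>Basis. c b *s b) = (\<Sum>b\<in>Basis. d b *s b)" "b \<in> Basis" for c d b
  proof -
    have "(\<Sum>b\<in>Basis. (c b - d b) *s b) = 0"
      using that by (simp add: scale_left_diff_distrib sum_subtractf)
    then show ?thesis
      using independentD[OF independent_Basis finite_Basis, of "\<lambda>b. c b - d b" b] that by simp
  qed
  have "u = 0" if "\<Phi> u = 0" for u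
  proof (rule killing_nondegenerate)
    fix y
    have "killing u b = 0" if "b \<in> Basis" for b
      using coord[of "killing u" "\<lambda>_. 0" b] \<open>\<Phi> u = 0\<close> that by (simp add: \<Phi>_def)
    then show "killing u y = 0"
      using on_basis[of u "\<lambda>_. 0"] vector_space_axioms l.vs2.vector_space_axioms
      by (simp add: Vector_Spaces.linear_iff)
  qed
  then have "inj \<Phi>" by (simp add: \<Phi>.inj_iff_eq_0)
  then obtain u where u: "\<Phi> u = (\<Sum>b\<in>Basis. l b *s b)"
    using linear_inj_imp_surj[OF lin] by (metis surjD)
  have "killing u b = l b" if "b \<in> Basis" for b
    using coord[of "killing u" l b] u that by (simp add: \<Phi>_def)
  then show ?thesis using on_basis[OF _ assms] by blast
qed

end

section \<open>Forms on a simple Lie algebra\<close>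

context fd_simple_lie_algebra
begin

definition bilinear_form :: "('g \<Rightarrow> 'g \<Rightarrow> complex) \<Rightarrow> bool"
  where "bilinear_form B \<longleftrightarrow>
    (\<forall>x y z. B (x + y) z = B x z + B y z) \<and> (\<forall>x y z. B z (x + y) = B z x + B z y) \<and>
    (\<forall>c x z. B (c *s x) z = c * B x z) \<and> (\<forall>c x z. B z (c *s x) = c * B z x)"

definition invariant_form :: "('g \<Rightarrow> 'g \<Rightarrow> complex) \<Rightarrow> bool"
  where "invariant_form B \<longleftrightarrow> bilinear_form B \<and> (\<forall>x y. B x y = B y x) \<and>
    (\<forall>x y z. B (bracket x y) z = B x (bracket y z))"

lemma bilinear_form_zero: "bilinear_form B \<Longrightarrow> B 0 y = 0" "bilinear_form B \<Longrightarrow> B y 0 = 0"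
  unfolding bilinear_form_def by (metis add_cancel_right_right)+

lemma bilinear_form_minus: "bilinear_form B \<Longrightarrow> B (- x) y = - B x y" "bilinear_form B \<Longrightarrow> B y (- x) = - B y x"
  unfolding bilinear_form_def by (metis mult_minus1 scale_minus_left scale_one)+

lemma bilinear_form_add: "bilinear_form B \<Longrightarrow> bilinear_form C \<Longrightarrow> bilinear_form (\<lambda>x y. B x y + C x y)"
  by (simp add: bilinear_form_def algebra_simps)

lemma bilinear_form_cmult: "bilinear_form B \<Longrightarrow> bilinear_form (\<lambda>x y. c * B x y)"
  by (simp add: bilinear_form_def algebra_simps)

lemma bilinear_form_flip: "bilinear_form B \<Longrightarrow> bilinear_form (\<lambda>x y. B y x)"
  by (simp add: bilinear_form_def)

lemma invariant_form_add: "invariant_form B \<Longrightarrow> invariant_form C \<Longrightarrow> invariant_form (\<lambda>x y. B x y + C x y)"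
  by (auto simp: invariant_form_def bilinear_form_add)

lemma invariant_form_cmult: "invariant_form B \<Longrightarrow> invariant_form (\<lambda>x y. c * B x y)"
  by (auto simp: invariant_form_def bilinear_form_cmult)

lemma invariant_form_cyclic: "invariant_form B \<Longrightarrow> B (bracket x y) z = B (bracket z x) y"
  unfolding invariant_form_def by metis

lemma killing_eqI:
  assumes "\<And>z. killing x z = killing y z"
  shows "x = y"
proof -
  have "killing (x - y) z = 0" for z
    using killing_add(1)[of "x - y" y z] assms by simp
  then show ?thesis using killing_nondegenerate[of "x - y"] by simp
qed

text \<open>\<open>der\<close> says that x to B x is a derivation into the coadjoint module. The
  Killing form turns it into a derivation E of the algebra, and \<open>killing_derivation\<close>
  gives the functional directly as w to tr (E ad w).\<close>

lemma coadjoint_derivation_inner: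
  assumes B: "bilinear_form B"
    and der: "\<And>x y z. B (bracket x y) z = B x (bracket y z) - B y (bracket x z)"
  shows "\<exists>\<rho>. Vector_Spaces.linear scale (*) \<rho> \<and> (\<forall>x y. B x y = \<rho> (bracket x y))"
proof -
  have C: "vector_space ((*) :: complex \<Rightarrow> complex \<Rightarrow> complex)"
    by unfold_locales (simp_all add: algebra_simps)
  note lin_form = Vector_Spaces.linear_iff[of scale "(*)"]
  have "Vector_Spaces.linear scale (*) (B x)" for x
    using B C vector_space_axioms by (simp add: lin_form bilinear_form_def)
  then have "\<exists>u. \<forall>y. killing u y = B x y" for x by (rule killing_represent)
  then obtain E where E: "\<And>x y. killing (E x) y = B x y" by metis
  have "lin E"
    unfolding Vector_Spaces.linear_iff using vector_space_axioms B
    by (auto intro!: killing_eqI simp: killing_add killing_scale E bilinear_form_def)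
  moreover have "E (bracket x y) = bracket (E x) y + bracket x (E y)" for x y
  proof (rule killing_eqI)
    fix z
    have "killing (bracket x (E y)) z = - killing (E y) (bracket x z)"
      using killing_invariant[of "E y" x z] bracket_anticomm[of x "E y"]
        killing_scale(1)[where c = "-1" and x = "bracket (E y) x" and z = z] by simp
    then show "killing (E (bracket x y)) z = killing (bracket (E x) y + bracket x (E y)) z"
      by (simp add: killing_add killing_invariant E der)
  qed
  ultimately have "derivation E" by (simp add: derivation_def)
  then have "B x y = tr (E \<circ> bracket (bracket x y))" for x y
    using killing_derivation E by metis
  moreover have "Vector_Spaces.linear scale (*) (\<lambda>w. tr (E \<circ> bracket w))"
  proof -
    interpret E: Vector_Spaces.linear scale scale E by fact
    show ?thesis
      using C vector_space_axioms
      by (simp add: lin_form o_def bracket_add_left bracket_scale_left E.add E.scale tr_add tr_scale)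
  qed
  ultimately show ?thesis by blast
qed

text \<open>\<open>\<alpha> + K\<close> is a derivation into the dual, hence a function of the
  bracket and antisymmetric, so its symmetric part K is zero. This contains Whitehead's second lemma
  (K = 0) and the non-exactness of the Cartan 3-form of a nonzero K.\<close>

lemma alternating_form_coboundary:
  assumes \<alpha>: "bilinear_form \<alpha>" "\<And>x y. \<alpha> x y = - \<alpha> y x" and K: "invariant_form K"
    and d\<alpha>: "\<And>x y z. \<alpha> (bracket x y) z + \<alpha> (bracket y z) x + \<alpha> (bracket z x) y = K (bracket x y) z"
  shows "K x y = 0" and "\<exists>\<rho>. Vector_Spaces.linear scale (*) \<rho> \<and> (\<forall>x y. \<alpha> x y = \<rho> (bracket x y))"
proof -
  have K': "bilinear_form K" "\<And>x y. K x y = K y x" "\<And>x y z. K (bracket x y) z = K x (bracket y z)"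
    using K by (auto simp: invariant_form_def)
  have "\<exists>\<rho>. Vector_Spaces.linear scale (*) \<rho> \<and> (\<forall>x y. \<alpha> x y + K x y = \<rho> (bracket x y))"
  proof (rule coadjoint_derivation_inner[OF bilinear_form_add[OF \<alpha>(1) K'(1)]])
    fix x y z
    have "\<alpha> (bracket z x) y = \<alpha> y (bracket x z)"
      using \<alpha>(2)[of "bracket z x" y] bracket_anticomm[of z x] bilinear_form_minus(2)[OF \<alpha>(1), of y "bracket x z"]
      by simp
    moreover have "\<alpha> (bracket y z) x = - \<alpha> x (bracket y z)" by (rule \<alpha>(2))
    moreover have "K y (bracket x z) = - K (bracket x y) z"
      using K'(3)[of y x z] bracket_anticomm[of y x] bilinear_form_minus(1)[OF K'(1), of "bracket x y" z]
      by simp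
    moreover have "K x (bracket y z) = K (bracket x y) z" by (simp add: K'(3))
    ultimately show "\<alpha> (bracket x y) z + K (bracket x y) z =
       \<alpha> x (bracket y z) + K x (bracket y z) - (\<alpha> y (bracket x z) + K y (bracket x z))"
      using d\<alpha>[of x y z] by (simp add: algebra_simps)
  qed
  then obtain \<rho> where \<rho>: "Vector_Spaces.linear scale (*) \<rho>" "\<And>x y. \<alpha> x y + K x y = \<rho> (bracket x y)"
    by blast
  interpret \<rho>: Vector_Spaces.linear scale "(*)" \<rho> by (rule \<rho>)
  have K0: "K x y = 0" for x y
  proof -
    have "\<rho> (bracket y x) = - \<rho> (bracket x y)"
      using bracket_anticomm[of y x] by (simp add: \<rho>.neg)
    then have "\<alpha> y x + K y x = - (\<alpha> x y + K x y)" by (simp only: \<rho>)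
    then show ?thesis using \<alpha>(2)[of x y] K'(2)[of x y] by simp
  qed
  then show "K x y = 0" .
  show "\<exists>\<rho>. Vector_Spaces.linear scale (*) \<rho> \<and> (\<forall>x y. \<alpha> x y = \<rho> (bracket x y))"
    using \<rho> K0 by (intro exI[of _ \<rho>]) simp
qed

lemma perfect_ext:
  assumes "bilinear_form B" "bilinear_form C" "\<And>x y. B (bracket x y) v = C (bracket x y) v"
  shows "B u v = C u v"
proof -
  have "u \<in> span {bracket a b | a b. True}" by (simp only: perfect UNIV_I)
  then show ?thesis
  proof (induction u rule: span_induct_alt)
    case base
    show ?case using bilinear_form_zero assms by metis
  next
    case (step c x y)
    then show ?case using assms by (auto simp: bilinear_form_def)
  qed
qed

text \<open>\<open>F(a, b, c, d) = B([a, b], [c, d])\<close> is alternating in each pair and satisfies the first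
  Bianchi identity, hence, like a curvature tensor, is symmetric under exchange of the pairs.\<close>

lemma invariant_formI:
  assumes B: "bilinear_form B" and zero: "\<And>x z. B (bracket x z) x = 0"
  shows "invariant_form B"
proof -
  have add: "B (x + y) z = B x z + B y z" "B z (x + y) = B z x + B z y" for x y z
    using B by (auto simp: bilinear_form_def)
  note minus = bilinear_form_minus[OF B]
  have swap13: "B (bracket x z) y = - B (bracket y z) x" for x y z
    using zero[of "x + y" z] by (simp add: add bracket_add_left zero add_eq_0_iff)
  have swap12: "B (bracket x y) z = - B (bracket y x) z" for x y z
    using bracket_anticomm[of x y] by (simp add: minus)
  have cyclic: "B (bracket x y) z = B (bracket y z) x" for x y z
    using swap13[of x y z] swap12[of z y x] by simp
  define F where "F a b c d = B (bracket a b) (bracket c d)" for a b c d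
  have anti: "F a b c d = - F b a c d" "F a b c d = - F a b d c" for a b c d
    using bracket_anticomm[of a b] bracket_anticomm[of c d] by (simp_all add: F_def minus)
  have bianchi: "F w z x y + F x z y w + F y z w x = 0" for w x y z
  proof -
    have eq: "F c d a b = B (bracket (bracket a b) c) d" for a b c d
      unfolding F_def using cyclic[of "bracket a b" c d] by simp
    have "B (bracket (bracket x y) w + bracket (bracket y w) x + bracket (bracket w x) y) z = 0"
    proof -
      have "bracket (bracket x y) w + bracket (bracket y w) x + bracket (bracket w x) y
          = - (bracket w (bracket x y) + bracket x (bracket y w) + bracket y (bracket w x))"
        using bracket_anticomm by (metis minus_add_distrib)
      also have "\<dots> = 0" by (simp only: jacobi minus_zero)
      finally show ?thesis by (simp only: bilinear_form_zero(1)[OF B])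
    qed
    then show ?thesis by (simp add: eq add)
  qed
  \<comment> \<open>The octahedron argument for curvature tensors: one Bianchi identity for each
    choice of the fixed entry among a, b, c, d.\<close>
  have pair: "F a b c d = F c d a b" for a b c d
    using bianchi[of a b c d] bianchi[of b c d a] bianchi[of c d a b] bianchi[of d a b c]
      anti[of a b c d] anti[of a b d c] anti[of b a c d] anti[of c d a b] anti[of d c a b] anti[of c d b a]
      anti[of a c b d] anti[of a c d b] anti[of c a b d] anti[of b d a c] anti[of d b a c] anti[of b d c a]
      anti[of a d b c] anti[of a d c b] anti[of d a b c] anti[of b c a d] anti[of c b a d] anti[of b c d a]
    by algebra
  have sym1: "B (bracket a b) (bracket c d) = B (bracket c d) (bracket a b)" for a b c d
    using pair[of a b c d] by (simp add: F_def)
  \<comment> \<open>Symmetry is known so far between brackets only; as brackets span, it extends to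
    one argument and then to the other.\<close>
  have sym2: "B z (bracket x y) = B (bracket x y) z" for x y z
    by (rule perfect_ext[OF B bilinear_form_flip[OF B]]) (rule sym1)
  have sym: "B x y = B y x" for x y
    by (rule perfect_ext[OF B bilinear_form_flip[OF B]]) (rule sym2[symmetric])
  show ?thesis
    using B sym cyclic by (auto simp: invariant_form_def)
qed

text \<open>The conditions make s additive in i + 2, so 2 s i = (i + 2) s 0, and s m = - s 0 becomes
  (m + 4) s 0 = 0. The bound on m serves to determine s 1: the index 4 is both 1 + 1 + 2 and 0 + 2 +
  2.\<close>

lemma antisymmetric_shifted_additive_zero:
  fixes s :: "nat \<Rightarrow> complex" and m :: nat
  assumes "m \<ge> 4" and anti: "\<And>i. i \<le> m \<Longrightarrow> s (m - i) = - s i"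
    and sum: "\<And>i j k. i + j + k + 2 = m \<Longrightarrow> s i + s j + s k = 0" and "i \<le> m"
  shows "s i = 0"
proof -
  have add: "s (i + j + 2) = s i + s j" if "i + j + 2 \<le> m" for i j
  proof -
    have "m - (m - (i + j + 2)) = i + j + 2" using that by simp
    with anti[of "m - (i + j + 2)"] sum[of i j "m - (i + j + 2)"] that show ?thesis
      by (simp add: add_eq_0_iff)
  qed
  have s2: "s 2 = 2 * s 0" using add[of 0 0] assms(1) by (simp add: eval_nat_numeral)
  have s4: "s 4 = 2 * s 1" "s 4 = s 0 + s 2"
    using add[of 1 1] add[of 0 2] assms(1) by (simp_all add: numeral_eq_Suc)
  have lin: "2 * s i = (of_nat i + 2) * s 0" if "i \<le> m" for i
    using that
  proof (induction i rule: less_induct)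
    case (less i)
    consider "i = 0" | "i = 1" | j where "i = 0 + j + 2"
      by (metis One_nat_def add.commute add_0 less_2_cases_iff le_Suc_ex not_less)
    then show ?case
    proof cases
      case 3
      then have "2 * s j = (of_nat j + 2) * s 0" using less by simp
      moreover have "s i = s 0 + s j" using 3 less.prems add[of 0 j] by simp
      ultimately show ?thesis using 3 by (simp add: algebra_simps)
    qed (use s2 s4 in \<open>auto simp: algebra_simps\<close>)
  qed
  have "2 * s m = - (2 * s 0)" using anti[of 0] by simp
  with lin[of m] have "(of_nat m + 4) * s 0 = 0" by (simp add: algebra_simps)
  moreover have "(of_nat m + 4 :: complex) \<noteq> 0"
    using of_nat_neq_0[of "m + 3", where 'a = complex] by (simp add: add.commute)
  ultimately have "s 0 = 0" by simp
  with lin[OF assms(4)] show ?thesis by simp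
qed

text \<open>\<open>\<psi> i x y\<close> stands for the value at x t^(m - i) and y t^i after both
  arguments are divided by t^2; the bracket of t^2 C[t] then adds 2 to the exponents, whence i + j +
  k + 2 = m.\<close>

lemma graded_cocycle_coboundary:
  fixes m :: nat
  assumes "m \<ge> 4" and bil: "\<And>i. bilinear_form (\<psi> i)"
    and anti: "\<And>i x y. i \<le> m \<Longrightarrow> \<psi> (m - i) x y = - \<psi> i y x"
    and cocycle: "\<And>i j k x y z. i + j + k + 2 = m \<Longrightarrow>
      \<psi> k (bracket x y) z + \<psi> i (bracket y z) x + \<psi> j (bracket z x) y = 0"
  shows "\<exists>\<rho>. Vector_Spaces.linear scale (*) \<rho> \<and> (\<forall>i\<le>m. \<forall>x y. \<psi> i x y = \<rho> (bracket x y))"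
proof -
  have diff: "invariant_form (\<lambda>x y. \<psi> i x y + (-1) * \<psi> 0 x y)" if i: "i + 2 \<le> m" for i
  proof (rule invariant_formI)
    show "bilinear_form (\<lambda>x y. \<psi> i x y + (-1) * \<psi> 0 x y)"
      by (intro bilinear_form_add bilinear_form_cmult bil)
    fix x z
    \<comment> \<open>The cocycle condition for x t^i, x and z t^(m - 2 - i).\<close>
    have "\<psi> (m - 2 - i) (bracket x x) z + \<psi> i (bracket x z) x + \<psi> 0 (bracket z x) x = 0"
      by (rule cocycle) (use i in simp)
    then show "\<psi> i (bracket x z) x + (-1) * \<psi> 0 (bracket x z) x = 0"
      using bracket_anticomm[of z x] by (simp add: bracket_self bilinear_form_zero[OF bil] bilinear_form_minus[OF bil])
  qed
  define \<alpha> where "\<alpha> x y = (\<psi> 0 x y - \<psi> 0 y x) / 2" for x y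
  define \<kappa> where "\<kappa> i x y = \<psi> i x y - \<alpha> x y" for i x y
  have \<alpha>: "bilinear_form \<alpha>" "\<alpha> x y = - \<alpha> y x" for x y
    using bil[of 0] by (auto simp: \<alpha>_def bilinear_form_def field_simps)
  have \<psi>: "\<psi> i x y = \<alpha> x y + \<kappa> i x y" for i x y by (simp add: \<kappa>_def)
  have inv_low: "invariant_form (\<kappa> i)" if i: "i + 2 \<le> m" for i
  proof -
    let ?D = "\<lambda>i x y. \<psi> i x y + (-1) * \<psi> 0 x y"
    \<comment> \<open>Antisymmetry relates the indices 2 and m - 2, and so expresses the symmetric
      part of \<open>\<psi> 0\<close> by differences already known to be invariant; both indices are
      admissible because m >= 4.\<close>
    have "\<psi> 0 x y + \<psi> 0 y x = - (?D 2 x y + ?D (m - 2) x y)" for x y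
    proof -
      have "?D (m - 2) x y = ?D (m - 2) y x"
        using diff[of "m - 2"] assms(1) by (simp add: invariant_form_def)
      then show ?thesis using anti[of 2 y x] assms(1) by simp
    qed
    then have flip: "\<psi> 0 y x = - \<psi> 0 x y - (?D 2 x y + ?D (m - 2) x y)" for x y
      by (metis add_diff_cancel_left' diff_minus_eq_add minus_diff_eq uminus_add_conv_diff)
    have "\<kappa> i = (\<lambda>x y. ?D i x y + (- 1 / 2) * (?D 2 x y + ?D (m - 2) x y))"
    proof (intro ext)
      fix x y
      show "\<kappa> i x y = ?D i x y + (- 1 / 2) * (?D 2 x y + ?D (m - 2) x y)"
        unfolding \<kappa>_def \<alpha>_def flip[of y x] by (simp add: field_simps)
    qed
    moreover have "invariant_form (\<lambda>x y. ?D i x y + (- 1 / 2) * (?D 2 x y + ?D (m - 2) x y))"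
      using assms(1) i by (intro invariant_form_add invariant_form_cmult[of _ "- 1 / 2"] diff) auto
    ultimately show ?thesis by simp
  qed
  have \<kappa>_anti': "\<kappa> (m - i) x y = - \<kappa> i y x" if "i \<le> m" for i x y
    using anti[OF that, of x y] \<alpha>(2)[of x y] by (simp add: \<kappa>_def)
  have inv: "invariant_form (\<kappa> i)" if i: "i \<le> m" for i
  proof (cases "i + 2 \<le> m")
    case False
    \<comment> \<open>The two top indices are reflected to 0 and 1.\<close>
    then have inv: "invariant_form (\<kappa> (m - i))" using assms(1) inv_low by simp
    have "\<kappa> i = (\<lambda>x y. (-1) * \<kappa> (m - i) x y)"
      using \<kappa>_anti'[of "m - i"] i inv by (intro ext) (simp add: invariant_form_def)
    then show ?thesis using invariant_form_cmult[OF inv, of "-1"] by simp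
  qed (rule inv_low)
  have sum0: "invariant_form (\<lambda>x y. (-1) * (\<kappa> i x y + (\<kappa> j x y + \<kappa> k x y)))"
    "\<alpha> (bracket x y) z + \<alpha> (bracket y z) x + \<alpha> (bracket z x) y
      = (-1) * (\<kappa> i (bracket x y) z + (\<kappa> j (bracket x y) z + \<kappa> k (bracket x y) z))"
    if m: "i + j + k + 2 = m" for i j k x y z
  proof -
    have cyc: "\<kappa> i (bracket y z) x = \<kappa> i (bracket x y) z" "\<kappa> j (bracket z x) y = \<kappa> j (bracket x y) z"
      using invariant_form_cyclic[OF inv[of i], of y z x] invariant_form_cyclic[OF inv[of j], of x y z] m
        invariant_form_cyclic[OF inv[of i], of z x y] by simp_all
    show "invariant_form (\<lambda>x y. (-1) * (\<kappa> i x y + (\<kappa> j x y + \<kappa> k x y)))"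
      using m by (intro invariant_form_cmult[of _ "-1"] invariant_form_add inv) auto
    show "\<alpha> (bracket x y) z + \<alpha> (bracket y z) x + \<alpha> (bracket z x) y
      = (-1) * (\<kappa> i (bracket x y) z + (\<kappa> j (bracket x y) z + \<kappa> k (bracket x y) z))"
      using cocycle[OF m, of x y z] unfolding \<psi> cyc by algebra
  qed
  \<comment> \<open>Up to sign the sum of the three forms has the coboundary of
    \<open>\<alpha>\<close> as its Cartan 3-form, hence vanishes. Scalar relations remain for each
    pair x, y.\<close>
  have "\<kappa> i x y + \<kappa> j x y + \<kappa> k x y = 0" if m: "i + j + k + 2 = m" for i j k x y
    using alternating_form_coboundary(1)[OF \<alpha> sum0[OF m], of x y] by algebra
  moreover have "\<kappa> (m - i) x y = - \<kappa> i x y" if "i \<le> m" for i x y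
    using \<kappa>_anti'[OF that, of x y] inv[OF that] by (simp add: invariant_form_def)
  ultimately have "\<kappa> i x y = 0" if "i \<le> m" for i x y
    using antisymmetric_shifted_additive_zero[of m "\<lambda>i. \<kappa> i x y" i] assms(1) that by blast
  moreover have "\<exists>\<rho>. Vector_Spaces.linear scale (*) \<rho> \<and> (\<forall>x y. \<alpha> x y = \<rho> (bracket x y))"
    by (rule alternating_form_coboundary(2)[OF \<alpha> sum0[of 0 0 "m - 2"]]) (use assms(1) in auto)
  ultimately show ?thesis by (auto simp: \<psi>)
qed

end

section \<open>Twisted cocycles on the current algebra\<close>

context lie_algebra
begin

text \<open>Multiplication by \<open>[:c\<^sub>0, c\<^sub>1, 1:]\<close>, written with shifts since
  the coefficients of \<open>P\<close> are vectors.\<close>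

definition quad_mult
  where "quad_mult c\<^sub>0 c\<^sub>1 P = pCons 0 (pCons 0 P) + poly_scale scale c\<^sub>1 (pCons 0 P) + poly_scale scale c\<^sub>0 P"

lemma coeff_quad_mult:
  "coeff (quad_mult c\<^sub>0 c\<^sub>1 P) (Suc (Suc n)) = coeff P n + scale c\<^sub>1 (coeff P (Suc n)) + scale c\<^sub>0 (coeff P (Suc (Suc n)))"
  "coeff (quad_mult c\<^sub>0 c\<^sub>1 P) (Suc 0) = scale c\<^sub>1 (coeff P 0) + scale c\<^sub>0 (coeff P (Suc 0))"
  "coeff (quad_mult c\<^sub>0 c\<^sub>1 P) 0 = scale c\<^sub>0 (coeff P 0)"
  by (simp_all add: quad_mult_def)

lemma poly_eqI3:
  assumes "coeff P 0 = coeff Q 0" "coeff P (Suc 0) = coeff Q (Suc 0)"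
    "\<And>n. coeff P (Suc (Suc n)) = coeff Q (Suc (Suc n))"
  shows "P = Q"
  using assms by (intro poly_eqI) (metis not0_implies_Suc)

lemma quad_mult_add: "quad_mult c\<^sub>0 c\<^sub>1 (P + Q) = quad_mult c\<^sub>0 c\<^sub>1 P + quad_mult c\<^sub>0 c\<^sub>1 Q"
  by (rule poly_eqI3) (simp_all add: coeff_quad_mult scale_right_distrib)

lemma quad_mult_scale: "quad_mult c\<^sub>0 c\<^sub>1 (poly_scale scale c P) = poly_scale scale c (quad_mult c\<^sub>0 c\<^sub>1 P)"
  by (rule poly_eqI3) (simp_all add: coeff_quad_mult scale_right_distrib mult.commute)

lemma quad_mult_tensor:
  "quad_mult c\<^sub>0 c\<^sub>1 (poly_tensor scale x p) = poly_tensor scale x (p * [:c\<^sub>0, c\<^sub>1, 1:])"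
  by (rule poly_eqI3)
    (simp_all add: coeff_quad_mult mult_pCons_right scale_left_distrib algebra_simps)

lemma monom_eq_tensor: "monom x i = poly_tensor scale x (monom 1 i)"
  by (rule poly_eqI) simp

lemma monom_scale: "monom (scale c x) i = poly_scale scale c (monom x i)"
  by (rule poly_eqI) simp

lemma quad_mult_monom:
  "quad_mult c\<^sub>0 c\<^sub>1 (monom x i)
     = monom x (i + 2) + poly_scale scale c\<^sub>1 (monom x (i + 1)) + poly_scale scale c\<^sub>0 (monom x i)"
  by (simp add: quad_mult_def monom_Suc numeral_2_eq_2)

lemma quad_mult_bracket_left:
  "poly_bracket bracket (quad_mult c\<^sub>0 c\<^sub>1 P) Q = quad_mult c\<^sub>0 c\<^sub>1 (poly_bracket bracket P Q)"
proof (induction P rule: poly_monom_add_induct)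
  case (1 x i)
  show ?case
  proof (induction Q rule: poly_monom_add_induct)
    case (1 y j)
    show ?case
      by (simp add: quad_mult_monom poly_bracket_add poly_bracket_scale poly_bracket_monom ac_simps)
  qed (simp add: poly_bracket_add quad_mult_add)
qed (simp add: poly_bracket_add quad_mult_add)

lemma quad_mult_bracket_right:
  "poly_bracket bracket P (quad_mult c\<^sub>0 c\<^sub>1 Q) = quad_mult c\<^sub>0 c\<^sub>1 (poly_bracket bracket P Q)"
proof -
  have "quad_mult c\<^sub>0 c\<^sub>1 (- R) = - quad_mult c\<^sub>0 c\<^sub>1 R" for R
    by (rule poly_eqI3) (simp_all add: coeff_quad_mult)
  then show ?thesis
    using quad_mult_bracket_left[of c\<^sub>0 c\<^sub>1 Q P] poly_bracket_anticomm by metis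
qed

lemma inj_quad_mult: "inj (quad_mult c\<^sub>0 c\<^sub>1)"
proof (rule injI)
  fix P Q assume eq: "quad_mult c\<^sub>0 c\<^sub>1 P = quad_mult c\<^sub>0 c\<^sub>1 Q"
  define R where "R = P - Q"
  have "quad_mult c\<^sub>0 c\<^sub>1 R + quad_mult c\<^sub>0 c\<^sub>1 Q = quad_mult c\<^sub>0 c\<^sub>1 P"
    using quad_mult_add[of c\<^sub>0 c\<^sub>1 R Q] by (simp add: R_def)
  \<comment> \<open>As the quadratic is monic, this coefficient is the leading coefficient of
    R.\<close>
  then have "coeff (quad_mult c\<^sub>0 c\<^sub>1 R) (Suc (Suc (degree R))) = 0"
    by (simp add: eq)
  then have "lead_coeff R = 0"
    by (simp add: coeff_quad_mult coeff_eq_0)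
  then have "R = 0" by (simp only: leading_coeff_0_iff)
  then show "P = Q" by (simp add: R_def)
qed

lemma tensor_ideal_eq_range:
  "tensor_ideal scale {q * [:c\<^sub>0, c\<^sub>1, 1:] | q. True} = range (quad_mult c\<^sub>0 c\<^sub>1)"
proof -
  interpret P: vector_space "poly_scale scale" by (rule vector_space_poly_scale)
  let ?S = "{poly_tensor scale x p | x p. p \<in> {q * [:c\<^sub>0, c\<^sub>1, 1:] | q. True}}"
  have "P.subspace (range (quad_mult c\<^sub>0 c\<^sub>1))"
  proof (rule P.subspaceI)
    have "quad_mult c\<^sub>0 c\<^sub>1 0 = 0" by (rule poly_eqI3) (simp_all add: coeff_quad_mult)
    then show "0 \<in> range (quad_mult c\<^sub>0 c\<^sub>1)" by (metis rangeI)
  qed (auto simp flip: quad_mult_add quad_mult_scale)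
  moreover have "?S \<subseteq> range (quad_mult c\<^sub>0 c\<^sub>1)"
    by (clarsimp simp del: mult_pCons_right) (metis quad_mult_tensor rangeI)
  ultimately have "P.span ?S \<subseteq> range (quad_mult c\<^sub>0 c\<^sub>1)" by (intro P.span_minimal)
  moreover have "quad_mult c\<^sub>0 c\<^sub>1 P \<in> P.span ?S" for P
  proof (induction P rule: poly_monom_add_induct)
    case (1 x i)
    show ?case
      unfolding monom_eq_tensor quad_mult_tensor by (rule P.span_base) blast
  qed (simp add: quad_mult_add P.span_add)
  ultimately show ?thesis by (auto simp: tensor_ideal_def)
qed

end

text \<open>The components of a functional h on g[t] with h (f t^n x) = r n x. The two free initial
  components reflect the quotient of g[t] by f g[t] and are set to zero.\<close>

fun recurrence_solution :: "'k::field \<Rightarrow> 'k \<Rightarrow> (nat \<Rightarrow> 'b \<Rightarrow> 'k) \<Rightarrow> nat \<Rightarrow> 'b \<Rightarrow> 'k"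
  where "recurrence_solution c\<^sub>0 c\<^sub>1 r 0 x = 0"
  | "recurrence_solution c\<^sub>0 c\<^sub>1 r (Suc 0) x = 0"
  | "recurrence_solution c\<^sub>0 c\<^sub>1 r (Suc (Suc n)) x = r n x
       - c\<^sub>1 * recurrence_solution c\<^sub>0 c\<^sub>1 r (Suc n) x - c\<^sub>0 * recurrence_solution c\<^sub>0 c\<^sub>1 r n x"

context fd_simple_lie_algebra
begin

lemma twisted_cocycle_graded:
  fixes w :: "'g poly \<Rightarrow> 'g poly \<Rightarrow> complex" and c\<^sub>0 c\<^sub>1 :: complex
  defines "M \<equiv> quad_mult c\<^sub>0 c\<^sub>1"
  assumes add: "\<And>P Q R. w (P + Q) R = w P R + w Q R" "\<And>P Q R. w R (P + Q) = w R P + w R Q"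
    and scale: "\<And>c P Q. w (poly_scale scale c P) Q = c * w P Q" "\<And>c P Q. w Q (poly_scale scale c P) = c * w Q P"
    and self: "\<And>P. w P P = 0"
    and cocycle: "\<And>P Q R. w (M (poly_bracket bracket P Q)) R + w (M (poly_bracket bracket Q R)) P
      + w (M (poly_bracket bracket R P)) Q = 0"
    and low: "\<And>x y i j. i + j \<le> 3 \<Longrightarrow> w (monom x i) (monom y j) = 0"
  shows "\<exists>\<rho>. Vector_Spaces.linear scale (*) \<rho> \<and>
    (\<forall>i j x y. i + j = m \<longrightarrow> w (monom x i) (monom y j) = \<rho> (bracket x y))"
proof (induction m rule: less_induct)
  case (less m)
  have anti: "w P Q = - w Q P" for P Q
    using self[of "P + Q", unfolded add] by (simp add: self eq_neg_iff_add_eq_0 add.commute)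
  show ?case
  proof (cases "m \<le> 3")
    case True
    have "Vector_Spaces.linear scale (*) (\<lambda>_. 0)"
      by unfold_locales (simp_all add: algebra_simps)
    with True low show ?thesis by (intro exI[of _ "\<lambda>_. 0"]) simp
  next
    case False
    then have "m - 1 < m" "m - 2 < m" by auto
    then obtain \<rho>\<^sub>1 \<rho>\<^sub>2 where lin: "Vector_Spaces.linear scale (*) \<rho>\<^sub>1" "Vector_Spaces.linear scale (*) \<rho>\<^sub>2"
      and \<rho>: "\<And>i j x y. i + j = m - 1 \<Longrightarrow> w (monom x i) (monom y j) = \<rho>\<^sub>1 (bracket x y)"
        "\<And>i j x y. i + j = m - 2 \<Longrightarrow> w (monom x i) (monom y j) = \<rho>\<^sub>2 (bracket x y)"
      using less by metis
    \<comment> \<open>Applied to the functionals of degrees m - 1 and m - 2, this cancels the lower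
      terms of the cocycle condition.\<close>
    have jac: "r (bracket (bracket x y) z) + r (bracket (bracket y z) x) + r (bracket (bracket z x) y) = 0"
      if "Vector_Spaces.linear scale (*) r" for r :: "'g \<Rightarrow> complex" and x y z
    proof -
      interpret r: Vector_Spaces.linear scale "(*)" r by (rule that)
      have "bracket (bracket x y) z + bracket (bracket y z) x + bracket (bracket z x) y
          = - (bracket x (bracket y z) + bracket y (bracket z x) + bracket z (bracket x y))"
        using bracket_anticomm[of "bracket x y" z] bracket_anticomm[of "bracket y z" x]
          bracket_anticomm[of "bracket z x" y] by simp
      also have "\<dots> = 0" by (simp only: jacobi minus_zero)
      finally have "r (bracket (bracket x y) z + bracket (bracket y z) x + bracket (bracket z x) y) = 0"
        by simp
      then show ?thesis by (simp add: r.add)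
    qed
    define \<psi> where "\<psi> i x y = w (monom x (m - i)) (monom y i)" for i x y
    have "\<exists>\<rho>. Vector_Spaces.linear scale (*) \<rho> \<and> (\<forall>i\<le>m. \<forall>x y. \<psi> i x y = \<rho> (bracket x y))"
    proof (rule graded_cocycle_coboundary)
      show "m \<ge> 4" using False by simp
      show "bilinear_form (\<psi> i)" for i
        by (simp add: bilinear_form_def \<psi>_def add scale monom_scale flip: add_monom)
      show "\<psi> (m - i) x y = - \<psi> i y x" if "i \<le> m" for i x y
        using that by (simp add: \<psi>_def anti[of "monom y (m - i)"])
      show "\<psi> k (bracket x y) z + \<psi> i (bracket y z) x + \<psi> j (bracket z x) y = 0"
        if m: "i + j + k + 2 = m" for i j k x y z
      proof -
        \<comment> \<open>The three terms of M t^(p + q) pair with t^r in degrees m, m - 1 and m -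
          2; the induction hypothesis evaluates the last two.\<close>
        have expand: "w (M (monom a (p + q))) (monom b r)
            = \<psi> r a b + c\<^sub>1 * \<rho>\<^sub>1 (bracket a b) + c\<^sub>0 * \<rho>\<^sub>2 (bracket a b)"
          if "p + q + r + 2 = m" for p q r a b
        proof -
          have "m - r = p + q + 2" using that by simp
          then have "\<psi> r a b = w (monom a (p + q + 2)) (monom b r)" by (simp only: \<psi>_def)
          moreover have "w (monom a (p + q + 1)) (monom b r) = \<rho>\<^sub>1 (bracket a b)"
            by (rule \<rho>(1)) (use that in simp)
          moreover have "w (monom a (p + q)) (monom b r) = \<rho>\<^sub>2 (bracket a b)"
            by (rule \<rho>(2)) (use that in simp)
          ultimately show ?thesis by (simp only: M_def quad_mult_monom add scale)
        qed
        have "w (M (monom (bracket x y) (i + j))) (monom z k) + w (M (monom (bracket y z) (j + k))) (monom x i)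
            + w (M (monom (bracket z x) (k + i))) (monom y j) = 0"
          using cocycle[of "monom x i" "monom y j" "monom z k"] by (simp only: poly_bracket_monom)
        then have "\<psi> k (bracket x y) z + \<psi> i (bracket y z) x + \<psi> j (bracket z x) y
          + c\<^sub>1 * (\<rho>\<^sub>1 (bracket (bracket x y) z) + \<rho>\<^sub>1 (bracket (bracket y z) x) + \<rho>\<^sub>1 (bracket (bracket z x) y))
          + c\<^sub>0 * (\<rho>\<^sub>2 (bracket (bracket x y) z) + \<rho>\<^sub>2 (bracket (bracket y z) x) + \<rho>\<^sub>2 (bracket (bracket z x) y)) = 0"
          using m by (subst (asm) (1 2 3) expand) (simp_all add: algebra_simps)
        then show ?thesis by (simp add: jac[OF lin(1)] jac[OF lin(2)])
      qed
    qed
    then obtain \<rho>\<^sub>3 where "Vector_Spaces.linear scale (*) \<rho>\<^sub>3" "\<And>i x y. i \<le> m \<Longrightarrow> \<psi> i x y = \<rho>\<^sub>3 (bracket x y)"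
      by blast
    moreover have "w (monom x i) (monom y j) = \<psi> j x y" if "i + j = m" for i j x y
      using that by (auto simp: \<psi>_def)
    ultimately show ?thesis by (intro exI[of _ \<rho>\<^sub>3]) auto
  qed
qed

text \<open>The functionals of the single degrees are joined into one h by prescribing h (M (x t^n))
  = \<open>\<rho> n x\<close>, which the recurrence solves.\<close>

lemma twisted_cocycle_coboundary:
  fixes w :: "'g poly \<Rightarrow> 'g poly \<Rightarrow> complex" and c\<^sub>0 c\<^sub>1 :: complex
  defines "M \<equiv> quad_mult c\<^sub>0 c\<^sub>1"
  assumes add: "\<And>P Q R. w (P + Q) R = w P R + w Q R" "\<And>P Q R. w R (P + Q) = w R P + w R Q"
    and scale: "\<And>c P Q. w (poly_scale scale c P) Q = c * w P Q" "\<And>c P Q. w Q (poly_scale scale c P) = c * w Q P"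
    and self: "\<And>P. w P P = 0"
    and cocycle: "\<And>P Q R. w (M (poly_bracket bracket P Q)) R + w (M (poly_bracket bracket Q R)) P
      + w (M (poly_bracket bracket R P)) Q = 0"
    and low: "\<And>x y i j. i + j \<le> 3 \<Longrightarrow> w (monom x i) (monom y j) = 0"
  shows "\<exists>h. (\<forall>P Q. h (P + Q) = h P + h Q) \<and> (\<forall>c P. h (poly_scale scale c P) = c * h P) \<and>
    (\<forall>P Q. w P Q = h (M (poly_bracket bracket P Q)))"
proof -
  have "\<forall>m. \<exists>\<rho>. Vector_Spaces.linear scale (*) \<rho> \<and>
    (\<forall>i j x y. i + j = m \<longrightarrow> w (monom x i) (monom y j) = \<rho> (bracket x y))"
    using twisted_cocycle_graded[OF assms(2-)[unfolded M_def]] by blast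
  then obtain \<rho> where \<rho>: "\<And>m. Vector_Spaces.linear scale (*) (\<rho> m)"
    "\<And>i j x y. w (monom x i) (monom y j) = \<rho> (i + j) (bracket x y)"
    by metis
  define l where "l = recurrence_solution c\<^sub>0 c\<^sub>1 \<rho>"
  have l: "l i (x + y) = l i x + l i y \<and> l i (c *s x) = c * l i x" for i c x y
  proof (induction i rule: less_induct)
    case (less i)
    consider "i = 0" | "i = Suc 0" | j where "i = Suc (Suc j)" by (metis not0_implies_Suc)
    then show ?case
    proof cases
      case 3
      interpret r: Vector_Spaces.linear scale "(*)" "\<rho> j" by (rule \<rho>)
      show ?thesis using 3 less[of j] less[of "Suc j"]
        by (simp add: l_def r.add r.scale right_diff_distrib distrib_left mult.left_commute)
    qed (simp_all add: l_def)
  qed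
  have l0: "l i 0 = 0" for i using l[of i 0 0] by simp
  define h where "h P = (\<Sum>i\<le>degree P. l i (coeff P i))" for P
  have h: "h P = (\<Sum>i\<le>n. l i (coeff P i))" if "degree P \<le> n" for P n
    unfolding h_def using that
    by (intro sum.mono_neutral_left) (auto simp: coeff_eq_0 l0)
  have h_add: "h (P + Q) = h P + h Q" for P Q
  proof -
    let ?n = "max (degree P) (degree Q)"
    have "degree (P + Q) \<le> ?n" by (rule degree_add_le_max)
    then show ?thesis by (simp add: h[of _ ?n] l[THEN conjunct1] sum.distrib)
  qed
  have h_scale: "h (poly_scale scale c P) = c * h P" for c P
  proof -
    have "degree (poly_scale scale c P) \<le> degree P"
      by (rule degree_le) (simp add: coeff_eq_0)
    then show ?thesis by (simp add: h[of _ "degree P"] l[THEN conjunct2] sum_distrib_left)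
  qed
  have h_monom: "h (monom x i) = l i x" for x i
  proof -
    have "h (monom x i) = (\<Sum>j\<le>i. if j = i then l i x else 0)"
      unfolding h[OF degree_monom_le] by (intro sum.cong) (auto simp: l0)
    then show ?thesis by simp
  qed
  have "w P Q = h (M (poly_bracket bracket P Q))" for P Q
  proof (induction P rule: poly_monom_add_induct)
    case (1 x i)
    show ?case
    proof (induction Q rule: poly_monom_add_induct)
      case (1 y j)
      have "h (M (monom a n)) = \<rho> n a" for a n
        by (simp add: M_def quad_mult_monom h_add h_scale h_monom l_def)
      then show ?case by (simp add: \<rho> poly_bracket_monom)
    qed (simp add: add poly_bracket_add M_def quad_mult_add h_add)
  qed (simp add: add poly_bracket_add M_def quad_mult_add h_add)
  with h_add h_scale show ?thesis by blast
qed

end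

section \<open>Duality between chains and cochains\<close>

lemma (in vector_space) separating_functional:
  assumes "x \<notin> span S"
  shows "\<exists>f. Vector_Spaces.linear scale (*) f \<and> (\<forall>s\<in>S. f s = 0) \<and> f x = 1"
proof -
  interpret K: vector_space "(*) :: 'a \<Rightarrow> 'a \<Rightarrow> 'a"
    by unfold_locales (simp_all add: algebra_simps)
  interpret P: vector_space_pair scale "(*)" ..
  obtain B where B: "B \<subseteq> S" "independent B" "S \<subseteq> span B"
    using maximal_independent_subset[of S] by blast
  have x: "x \<notin> span B" using assms B(1) span_mono by blast
  then have "independent (insert x B)" using B(2) by (rule independent_insertI)
  from P.linear_independent_extend[OF this, of "\<lambda>b. if b = x then 1 else 0"]
  obtain f where f: "Vector_Spaces.linear scale (*) f" "\<And>b. b \<in> insert x B \<Longrightarrow> f b = (if b = x then 1 else 0)"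
    by blast
  interpret f: Vector_Spaces.linear scale "(*)" f by (rule f)
  have "x \<notin> B" using x span_base by blast
  then have "f b = 0" if "b \<in> B" for b using f(2)[of b] that by auto
  then have "f s = 0" if "s \<in> S" for s
    using f.eq_0_on_span[of B] B(3) that by blast
  with f show ?thesis by auto
qed

section \<open>Pairing of finitely supported chains with arbitrary functions\<close>

definition pairing :: "('b \<Rightarrow> 'k::field) \<Rightarrow> ('b \<Rightarrow>\<^sub>0 'k) \<Rightarrow> 'k"
  where "pairing \<omega> u = (\<Sum>xs\<in>Poly_Mapping.keys u. Poly_Mapping.lookup u xs * \<omega> xs)"

lemma pairing_eq_sum:
  assumes "finite A" "Poly_Mapping.keys u \<subseteq> A"
  shows "pairing \<omega> u = (\<Sum>xs\<in>A. Poly_Mapping.lookup u xs * \<omega> xs)"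
  unfolding pairing_def using assms
  by (intro sum.mono_neutral_left) (auto simp: in_keys_iff)

lemma pairing_add: "pairing \<omega> (u + v) = pairing \<omega> u + pairing \<omega> v"
proof -
  let ?A = "Poly_Mapping.keys u \<union> Poly_Mapping.keys v"
  have "Poly_Mapping.keys (u + v) \<subseteq> ?A" by (rule Poly_Mapping.keys_add)
  then show ?thesis
    by (simp add: pairing_eq_sum[of ?A] lookup_add distrib_right sum.distrib)
qed

lemma pairing_scale: "pairing \<omega> (chain_scale c u) = c * pairing \<omega> u"
proof -
  have "Poly_Mapping.keys (chain_scale c u) \<subseteq> Poly_Mapping.keys u"
    by (auto simp: in_keys_iff)
  then show ?thesis
    by (simp add: pairing_eq_sum[of "Poly_Mapping.keys u"] sum_distrib_left mult.assoc)
qed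

lemma linear_pairing: "Vector_Spaces.linear chain_scale (*) (pairing \<omega>)"
proof -
  have "vector_space ((*) :: 'k::field \<Rightarrow> 'k \<Rightarrow> 'k)" by unfold_locales (simp_all add: algebra_simps)
  then show ?thesis
    by (simp add: Vector_Spaces.linear_iff vector_space_chain_scale pairing_add pairing_scale)
qed

lemma pairing_single [simp]: "pairing \<omega> (Poly_Mapping.single xs c) = c * \<omega> xs"
  by (simp add: pairing_eq_sum[of "{xs}"])

lemma pairing_indicator: "pairing (\<lambda>xs. if xs = ys then 1 else 0) u = Poly_Mapping.lookup u ys"
  by (simp add: pairing_def in_keys_iff if_distrib cong: if_cong)

lemma pairing_cong: "(\<And>xs. xs \<in> Poly_Mapping.keys u \<Longrightarrow> \<omega> xs = \<eta> xs) \<Longrightarrow> pairing \<omega> u = pairing \<eta> u"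
  by (simp add: pairing_def)

lemma functional_eq_pairing:
  assumes "Vector_Spaces.linear chain_scale (*) W"
  shows "W u = pairing (\<lambda>xs. W (Poly_Mapping.single xs 1)) u"
proof -
  interpret W: Vector_Spaces.linear chain_scale "(*)" W by (rule assms)
  have "u = (\<Sum>xs\<in>Poly_Mapping.keys u. chain_scale (Poly_Mapping.lookup u xs) (Poly_Mapping.single xs 1))"
    by (rule poly_mapping_eqI) (simp add: lookup_sum lookup_single when_def in_keys_iff if_distrib cong: if_cong)
  then have "W u = W (\<Sum>xs\<in>Poly_Mapping.keys u. chain_scale (Poly_Mapping.lookup u xs) (Poly_Mapping.single xs 1))"
    by (rule arg_cong)
  then show ?thesis by (simp add: W.sum W.scale pairing_def)
qed

lemma pairing_boundary:
  "pairing \<omega> (chain_boundary bracket u)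
     = pairing (\<lambda>xs. \<Sum>j<length xs. \<Sum>i<j. (-1) ^ (i + j) * \<omega> (contract bracket i j xs)) u"
proof -
  interpret p: Vector_Spaces.linear chain_scale "(*)" "pairing \<omega>" by (rule linear_pairing)
  have "pairing \<omega> (chain_boundary bracket u) = (\<Sum>xs\<in>Poly_Mapping.keys u. \<Sum>j<length xs. \<Sum>i<j.
      ((-1) ^ (i + j) * Poly_Mapping.lookup u xs) * \<omega> (contract bracket i j xs))"
    by (simp only: chain_boundary_def p.sum pairing_single)
  also have "\<dots> = pairing (\<lambda>xs. \<Sum>j<length xs. \<Sum>i<j. (-1) ^ (i + j) * \<omega> (contract bracket i j xs)) u"
    unfolding pairing_def sum_distrib_left by (intro sum.cong refl) (simp only: mult_ac)
  finally show ?thesis .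
qed

text \<open>Additivity is hidden in the definition, as the support of u + v can be smaller than the
  union of the supports. Coefficients are pairings with indicators, and
  \<open>pairing_boundary\<close> moves the boundary onto the function.\<close>

lemma linear_chain_boundary:
  fixes bracket :: "'b \<Rightarrow> 'b \<Rightarrow> 'b"
  shows "Vector_Spaces.linear (chain_scale :: 'k::field \<Rightarrow> _) chain_scale (chain_boundary bracket)"
proof -
  have "chain_boundary bracket (u + v) = chain_boundary bracket u + chain_boundary bracket v"
    for u v :: "'b list \<Rightarrow>\<^sub>0 'k"
    by (rule poly_mapping_eqI)
      (simp only: lookup_add pairing_indicator[symmetric], simp only: pairing_boundary pairing_add)
  moreover have "chain_boundary bracket (chain_scale c u) = chain_scale c (chain_boundary bracket u)"
    for c and u :: "'b list \<Rightarrow>\<^sub>0 'k"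
    by (rule poly_mapping_eqI)
      (simp only: lookup_chain_scale pairing_indicator[symmetric], simp only: pairing_boundary pairing_scale)
  ultimately show ?thesis
    by (simp add: Vector_Spaces.linear_iff vector_space_chain_scale)
qed

lemma length_contract:
  assumes "i < j" "j < length xs"
  shows "length (contract bracket i j xs) = length xs - 1"
proof -
  have "{k. k < length xs \<and> k \<in> - {i, j}} = {..<length xs} - {i, j}" by auto
  moreover have "card ({..<length xs} - {i, j}) = length xs - 2"
    using assms by (subst card_Diff_subset) auto
  ultimately show ?thesis using assms by (simp add: contract_def length_nths)
qed

text \<open>A new point g costs at most one more function, vanishing on G but not at g; if V has
  none, agreement on G forces agreement at g.\<close>

lemma finite_restriction_basis:
  fixes V :: "('b \<Rightarrow> 'k::field) set"
  assumes V: "module.subspace cochain_scale V" and "finite G"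
  shows "\<exists>B. finite B \<and> B \<subseteq> V \<and> (\<forall>\<omega>\<in>V. \<exists>u\<in>module.span cochain_scale B. \<forall>x\<in>G. u x = \<omega> x)"
  using \<open>finite G\<close>
proof (induction G rule: finite_induct)
  case empty
  interpret vector_space cochain_scale by (rule vector_space_cochain_scale)
  show ?case using span_zero by (intro exI[of _ "{}"]) auto
next
  case (insert g G)
  interpret vector_space cochain_scale by (rule vector_space_cochain_scale)
  from insert obtain B where B: "finite B" "B \<subseteq> V"
    and app: "\<And>\<omega>. \<omega> \<in> V \<Longrightarrow> \<exists>u\<in>span B. \<forall>x\<in>G. u x = \<omega> x" by blast
  show ?case
  proof (cases "\<exists>\<eta>\<in>V. (\<forall>x\<in>G. \<eta> x = 0) \<and> \<eta> g \<noteq> 0")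
    case True
    then obtain \<eta> where \<eta>: "\<eta> \<in> V" "\<And>x. x \<in> G \<Longrightarrow> \<eta> x = 0" "\<eta> g \<noteq> 0" by blast
    have "\<exists>u\<in>span (insert \<eta> B). \<forall>x\<in>insert g G. u x = \<omega> x" if \<omega>: "\<omega> \<in> V" for \<omega>
    proof -
      obtain u where u: "u \<in> span B" "\<And>x. x \<in> G \<Longrightarrow> u x = \<omega> x" using app[OF \<omega>] by blast
      let ?v = "u + cochain_scale ((\<omega> g - u g) / \<eta> g) \<eta>"
      have "u \<in> span (insert \<eta> B)" using u(1) span_mono[of B "insert \<eta> B"] by blast
      then have "?v \<in> span (insert \<eta> B)"
        by (intro span_add span_scale) (auto intro: span_base)
      moreover have "?v x = \<omega> x" if "x \<in> insert g G" for x
        using that u(2) \<eta> by (auto simp: cochain_scale_def plus_fun_def)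
      ultimately show ?thesis by blast
    qed
    with B \<eta>(1) show ?thesis by (intro exI[of _ "insert \<eta> B"]) auto
  next
    case False
    have "\<exists>u\<in>span B. \<forall>x\<in>insert g G. u x = \<omega> x" if \<omega>: "\<omega> \<in> V" for \<omega>
    proof -
      obtain u where u: "u \<in> span B" "\<And>x. x \<in> G \<Longrightarrow> u x = \<omega> x" using app[OF \<omega>] by blast
      have "u \<in> V" using u(1) span_minimal[OF B(2) V] by blast
      then have "u - \<omega> \<in> V" using \<omega> V subspace_diff by blast
      with False u(2) have "(u - \<omega>) g = 0" by (force simp: fun_diff_def)
      with u show ?thesis by (auto simp: fun_diff_def)
    qed
    with B show ?thesis by blast
  qed
qed

section \<open>Homology and cohomology of a subalgebra, tested on finitely many tuples\<close>

locale lie_subalgebra = lie_algebra scale bracket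
  for scale :: "'k::field \<Rightarrow> 'g::ab_group_add \<Rightarrow> 'g" and bracket +
  fixes L :: "'g set"
  assumes subspace_L: "subspace L" and bracket_L: "x \<in> L \<Longrightarrow> y \<in> L \<Longrightarrow> bracket x y \<in> L"
begin

sublocale chains: vector_space "chain_scale :: 'k \<Rightarrow> ('g list \<Rightarrow>\<^sub>0 'k) \<Rightarrow> _"
  by (rule vector_space_chain_scale)

sublocale cochains: vector_space "cochain_scale :: 'k \<Rightarrow> ('g list \<Rightarrow> 'k) \<Rightarrow> _"
  by (rule vector_space_cochain_scale)

lemma contract_tuples:
  assumes "set xs \<subseteq> L" "i < j" "j < length xs"
  shows "contract bracket i j xs \<in> tuples (length xs - 1) L"
proof -
  have "xs ! i \<in> L" "xs ! j \<in> L" using assms by (auto simp: subset_iff)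
  then have "bracket (xs ! i) (xs ! j) \<in> L" by (rule bracket_L)
  moreover have "set (nths xs (- {i, j})) \<subseteq> L" using assms(1) set_nths_subset by fast
  ultimately have "set (contract bracket i j xs) \<subseteq> L" by (simp add: contract_def)
  with assms show ?thesis by (simp add: tuples_def length_contract)
qed

lemma lie_coboundary_eq_0:
  assumes "\<And>ys. ys \<notin> tuples n L \<Longrightarrow> \<omega> ys = 0" and "xs \<notin> tuples (n + 1) L"
  shows "lie_coboundary bracket L \<omega> xs = 0"
proof -
  have "\<omega> (contract bracket i j xs) = 0" if "set xs \<subseteq> L" "i < j" "j < length xs" for i j
  proof (rule assms(1))
    show "contract bracket i j xs \<notin> tuples n L"
      using assms(2) that length_contract[OF that(2,3), of bracket] by (auto simp: tuples_def)
  qed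
  then show ?thesis by (simp add: lie_coboundary_def)
qed

lemma pairing_boundary_coboundary:
  assumes "u \<in> free_chains n L"
  shows "pairing \<omega> (chain_boundary bracket u) = pairing (lie_coboundary bracket L \<omega>) u"
proof -
  have "set xs \<subseteq> L" if "xs \<in> Poly_Mapping.keys u" for xs
    using assms that by (auto simp: free_chains_def tuples_def)
  then show ?thesis
    unfolding pairing_boundary by (intro pairing_cong) (simp add: lie_coboundary_def)
qed

lemma pairing_exterior_relations:
  assumes "\<omega> \<in> lie_cochains scale n L" "r \<in> exterior_relations scale n L"
  shows "pairing \<omega> r = 0"
proof -
  interpret p: Vector_Spaces.linear chain_scale "(*)" "pairing \<omega>" by (rule linear_pairing)
  show ?thesis
    using assms(2) unfolding exterior_relations_def
  proof (rule p.eq_0_on_span[rotated])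
  qed (use assms(1) in \<open>auto simp: lie_cochains_def p.diff p.scale\<close>)
qed

text \<open>A functional killing the relations descends to the exterior power. Its values off the
  n-tuples of L are cut to zero to fit the encoding of cochains.\<close>

lemma functional_cochain:
  assumes W: "Vector_Spaces.linear chain_scale (*) W"
    and rel: "\<And>r. r \<in> exterior_relations scale n L \<Longrightarrow> W r = 0"
  shows "(\<lambda>xs. if xs \<in> tuples n L then W (Poly_Mapping.single xs 1) else 0) \<in> lie_cochains scale n L"
proof -
  interpret W: Vector_Spaces.linear chain_scale "(*)" W by (rule W)
  have t: "us @ (x + y) # vs \<in> tuples n L" "us @ y # vs \<in> tuples n L" "us @ scale c x # vs \<in> tuples n L"
    if "us @ x # vs \<in> tuples n L" "y \<in> L" for us vs x y c
    using that subspace_add[OF subspace_L] subspace_scale[OF subspace_L] by (auto simp: tuples_def)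
  have "W (Poly_Mapping.single (us @ (x + y) # vs) 1)
      = W (Poly_Mapping.single (us @ x # vs) 1) + W (Poly_Mapping.single (us @ y # vs) 1)"
    if "us @ x # vs \<in> tuples n L" "y \<in> L" for us vs x y
  proof -
    have "W (Poly_Mapping.single (us @ (x + y) # vs) 1
        - Poly_Mapping.single (us @ x # vs) 1 - Poly_Mapping.single (us @ y # vs) 1) = 0"
      by (intro rel[unfolded exterior_relations_def] chains.span_base UnI1) (use that in blast)
    then show ?thesis by (simp add: W.diff W.add algebra_simps)
  qed
  moreover have "W (Poly_Mapping.single (us @ scale c x # vs) 1) = c * W (Poly_Mapping.single (us @ x # vs) 1)"
    if "us @ x # vs \<in> tuples n L" for us vs x c
  proof -
    have "W (Poly_Mapping.single (us @ scale c x # vs) 1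
        - chain_scale c (Poly_Mapping.single (us @ x # vs) 1)) = 0"
      by (intro rel[unfolded exterior_relations_def] chains.span_base UnI1 UnI2) (use that in blast)
    then show ?thesis by (simp add: W.diff W.scale)
  qed
  moreover have "W (Poly_Mapping.single xs 1) = 0" if "xs \<in> tuples n L" "\<not> distinct xs" for xs
    by (intro rel[unfolded exterior_relations_def] chains.span_base UnI2) (use that in blast)
  ultimately show ?thesis
    unfolding lie_cochains_def mem_Collect_eq using t(3)[OF _ subspace_0[OF subspace_L]]
    by (intro conjI allI impI ballI) (simp_all add: t, use t(2) in blast)
qed

lemma subspace_lie_cochains: "cochains.subspace (lie_cochains scale n L)"
proof (rule cochains.subspaceI)
  show "0 \<in> lie_cochains scale n L" by (simp add: lie_cochains_def zero_fun_def)
qed (simp_all add: lie_cochains_def plus_fun_def cochain_scale_def algebra_simps)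

lemma linear_lie_coboundary:
  "Vector_Spaces.linear cochain_scale cochain_scale (lie_coboundary bracket L)"
  by (auto simp: Vector_Spaces.linear_iff vector_space_cochain_scale lie_coboundary_def
      cochain_scale_def plus_fun_def fun_eq_iff distrib_left sum.distrib sum_distrib_left mult.left_commute)

lemma subspace_lie_boundaries: "chains.subspace (lie_boundaries scale bracket n L)"
proof -
  interpret d: Vector_Spaces.linear chain_scale chain_scale "chain_boundary bracket"
    by (rule linear_chain_boundary)
  have free: "chains.subspace (free_chains (n + 1) L)"
  proof (rule chains.subspaceI)
    show "u + v \<in> free_chains (n + 1) L" if "u \<in> free_chains (n + 1) L" "v \<in> free_chains (n + 1) L" for u v
      using that Poly_Mapping.keys_add[of u v] by (auto simp: free_chains_def)
    show "chain_scale c u \<in> free_chains (n + 1) L" if "u \<in> free_chains (n + 1) L" for c u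
      using that by (auto simp: free_chains_def in_keys_iff subset_iff)
  qed (simp add: free_chains_def)
  have "lie_boundaries scale bracket n L
      = {x + y | x y. x \<in> chain_boundary bracket ` free_chains (n + 1) L \<and> y \<in> exterior_relations scale n L}"
    by (auto simp: lie_boundaries_def)
  then show ?thesis
    using chains.subspace_sums[OF d.subspace_image[OF free], of "exterior_relations scale n L"]
    by (simp add: exterior_relations_def)
qed

text \<open>A functional on the chains that vanishes on the boundaries is a cocycle; by the hypothesis, if
  it also vanishes on \<open>G\<close>, it is a coboundary and so vanishes on all cycles. Hence the finitely many
  chains given by \<open>G\<close> span all cycles modulo boundaries.\<close>

lemma finite_dim_homology_cohomology:
  assumes G: "finite G" "G \<subseteq> tuples n L"
    and cobound: "\<And>\<omega>. \<omega> \<in> lie_cochains scale n L \<Longrightarrow> lie_coboundary bracket L \<omega> = 0 \<Longrightarrow>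
      (\<And>xs. xs \<in> G \<Longrightarrow> \<omega> xs = 0) \<Longrightarrow> \<exists>\<mu>\<in>lie_cochains scale (n - 1) L. \<omega> = lie_coboundary bracket L \<mu>"
  shows "finite_dim_quotient chain_scale (lie_homology scale bracket n L)"
    and "finite_dim_quotient cochain_scale (lie_cohomology scale bracket n L)"
proof -
  interpret d: Vector_Spaces.linear chain_scale chain_scale "chain_boundary bracket"
    by (rule linear_chain_boundary)
  let ?Z = "lie_cycles scale bracket n L" and ?B = "lie_boundaries scale bracket n L"
  define S :: "('g list \<Rightarrow>\<^sub>0 'k) set" where "S = (\<lambda>xs. Poly_Mapping.single xs 1) ` G"
  have B: "chains.subspace ?B" by (rule subspace_lie_boundaries)
  have Z_span: "z \<in> chains.span (S \<union> ?B)" if z: "z \<in> ?Z" for z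
  proof (rule ccontr)
    assume "z \<notin> chains.span (S \<union> ?B)"
    then obtain W where W: "Vector_Spaces.linear chain_scale (*) W" "\<And>s. s \<in> S \<union> ?B \<Longrightarrow> W s = 0" "W z = 1"
      using chains.separating_functional by blast
    define \<omega> where "\<omega> xs = (if xs \<in> tuples n L then W (Poly_Mapping.single xs 1) else 0)" for xs
    have W_\<omega>: "W u = pairing \<omega> u" if "u \<in> free_chains n L" for u
      unfolding functional_eq_pairing[OF W(1), of u] using that
      by (intro pairing_cong) (auto simp: free_chains_def \<omega>_def)
    have "r \<in> ?B" if "r \<in> exterior_relations scale n L" for r
    proof -
      have "r = chain_boundary bracket 0 + r" by simp
      moreover have "0 \<in> free_chains (n + 1) L" by (simp add: free_chains_def)
      ultimately show ?thesis using that unfolding lie_boundaries_def by blast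
    qed
    then have \<omega>: "\<omega> \<in> lie_cochains scale n L"
      using functional_cochain[OF W(1)] W(2) unfolding \<omega>_def by blast
    have "lie_coboundary bracket L \<omega> xs = 0" for xs
    proof (cases "xs \<in> tuples (n + 1) L")
      case True
      let ?u = "Poly_Mapping.single xs (1::'k)"
      have u: "?u \<in> free_chains (n + 1) L" using True by (simp add: free_chains_def)
      have "lie_coboundary bracket L \<omega> xs = pairing \<omega> (chain_boundary bracket ?u)"
        by (simp add: pairing_boundary_coboundary[OF u])
      also have "\<dots> = pairing (\<lambda>xs. W (Poly_Mapping.single xs 1)) (chain_boundary bracket ?u)"
      proof -
        have "\<omega> (contract bracket i j xs) = W (Poly_Mapping.single (contract bracket i j xs) 1)"
          if "i < j" "j < length xs" for i j
          using contract_tuples[OF _ that] True by (simp add: \<omega>_def tuples_def)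
        then show ?thesis by (simp add: pairing_boundary)
      qed
      also have "\<dots> = W (chain_boundary bracket ?u)"
        by (rule functional_eq_pairing[OF W(1), symmetric])
      finally have eq: "lie_coboundary bracket L \<omega> xs = W (chain_boundary bracket ?u)" .
      have "chain_boundary bracket ?u = chain_boundary bracket ?u + 0" by simp
      moreover have "0 \<in> exterior_relations scale n L"
        by (simp add: exterior_relations_def chains.span_zero)
      ultimately have "chain_boundary bracket ?u \<in> ?B"
        unfolding lie_boundaries_def using u by blast
      then show ?thesis using eq W(2) by simp
    next
      case False
      then show ?thesis by (intro lie_coboundary_eq_0[of n]) (simp_all add: \<omega>_def)
    qed
    then have "lie_coboundary bracket L \<omega> = 0" by (simp add: fun_eq_iff)
    moreover have "\<omega> xs = 0" if "xs \<in> G" for xs using that W(2) by (simp add: \<omega>_def S_def)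
    ultimately obtain \<mu> where \<mu>: "\<mu> \<in> lie_cochains scale (n - 1) L" "\<omega> = lie_coboundary bracket L \<mu>"
      using cobound \<omega> by blast
    \<comment> \<open>The boundary of a cycle lies in the relations, where \<open>\<mu>\<close>
      vanishes; this contradicts W z = 1.\<close>
    have "W z = pairing \<omega> z" using z W_\<omega> by (simp add: lie_cycles_def)
    also have "\<dots> = pairing \<mu> (chain_boundary bracket z)"
      using z by (simp add: \<mu> pairing_boundary_coboundary[of z n] lie_cycles_def)
    also have "\<dots> = 0"
      using z \<mu>(1) by (intro pairing_exterior_relations) (auto simp: lie_cycles_def)
    finally show False using W(3) by simp
  qed
  \<comment> \<open>The chains in S need not be cycles, but the spanning vectors must lie in
    homology classes; so a basis is taken of the part of span S made of such vectors.\<close>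
  let ?V = "{z + w | z w. z \<in> ?Z \<and> w \<in> ?B} \<inter> chains.span S"
  obtain C where C: "C \<subseteq> ?V" "chains.independent C" "?V \<subseteq> chains.span C"
    using chains.maximal_independent_subset[of ?V] by blast
  have "finite C"
    using chains.independent_span_bound[of S C] C G(1) by (auto simp: S_def)
  moreover have "C \<subseteq> \<Union> (lie_homology scale bracket n L)"
    using C(1) by (force simp: lie_homology_def quotient_space_def)
  moreover have "X \<inter> chains.span C \<noteq> {}" if "X \<in> lie_homology scale bracket n L" for X
  proof -
    from that obtain z where z: "z \<in> ?Z" "X = {z + w | w. w \<in> ?B}"
      by (auto simp: lie_homology_def quotient_space_def)
    from Z_span[OF z(1)] obtain s w where sw: "s \<in> chains.span S" "w \<in> ?B" "z = s + w"
      using B by (auto simp: chains.span_Un chains.span_eq_iff[THEN iffD2])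
    then have "s = z + (- w)" "- w \<in> ?B" using chains.subspace_neg[OF B] by auto
    then have "s \<in> X" "s \<in> ?V" using z sw(1) by blast+
    with C(3) show ?thesis by blast
  qed
  ultimately show "finite_dim_quotient chain_scale (lie_homology scale bracket n L)"
    unfolding finite_dim_quotient_def by blast
next
  interpret d: Vector_Spaces.linear cochain_scale cochain_scale "lie_coboundary bracket L"
    by (rule linear_lie_coboundary)
  let ?Z = "{\<omega> \<in> lie_cochains scale n L. lie_coboundary bracket L \<omega> = 0}"
  have "?Z = lie_cochains scale n L \<inter> {\<omega>. lie_coboundary bracket L \<omega> = 0}" by blast
  then have Z: "cochains.subspace ?Z"
    using cochains.subspace_inter[OF subspace_lie_cochains d.subspace_kernel] by (simp only:)
  \<comment> \<open>Cocycles that agree on G differ by a coboundary, so finitely many cocycles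
    realizing all restrictions to G suffice.\<close>
  obtain C where "finite C \<and> C \<subseteq> ?Z \<and> (\<forall>\<omega>\<in>?Z. \<exists>u\<in>cochains.span C. \<forall>xs\<in>G. u xs = \<omega> xs)"
    using finite_restriction_basis[OF Z G(1)] ..
  then have C: "finite C" "C \<subseteq> ?Z"
    and app: "\<And>\<omega>. \<omega> \<in> ?Z \<Longrightarrow> \<exists>u\<in>cochains.span C. \<forall>xs\<in>G. u xs = \<omega> xs"
    by blast+
  have zero: "0 \<in> lie_coboundary bracket L ` lie_cochains scale (n - 1) L"
    using cochains.subspace_0[OF subspace_lie_cochains] d.zero by (metis imageI)
  have "C \<subseteq> \<Union> (lie_cohomology scale bracket n L)"
  proof
    fix c assume "c \<in> C"
    moreover have "c = c + 0" by simp
    ultimately show "c \<in> \<Union> (lie_cohomology scale bracket n L)"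
      unfolding lie_cohomology_def quotient_space_def using C(2) zero by blast
  qed
  moreover have "X \<inter> cochains.span C \<noteq> {}" if "X \<in> lie_cohomology scale bracket n L" for X
  proof -
    from that obtain \<omega> where \<omega>: "\<omega> \<in> ?Z"
      and X: "X = {\<omega> + w | w. w \<in> lie_coboundary bracket L ` lie_cochains scale (n - 1) L}"
      by (auto simp: lie_cohomology_def quotient_space_def)
    obtain u where u: "u \<in> cochains.span C" "\<And>xs. xs \<in> G \<Longrightarrow> u xs = \<omega> xs"
      using app[OF \<omega>] by blast
    have "u \<in> ?Z" using u(1) cochains.span_minimal[OF C(2) Z] by blast
    then have "u - \<omega> \<in> ?Z" using \<omega> by (rule cochains.subspace_diff[OF Z])
    then obtain \<mu> where "\<mu> \<in> lie_cochains scale (n - 1) L" "u - \<omega> = lie_coboundary bracket L \<mu>"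
      using cobound[of "u - \<omega>"] u(2) by (auto simp: fun_diff_def)
    moreover have "u = \<omega> + (u - \<omega>)" by simp
    ultimately have "u \<in> X" unfolding X by blast
    with u(1) show ?thesis by blast
  qed
  ultimately show "finite_dim_quotient cochain_scale (lie_cohomology scale bracket n L)"
    unfolding finite_dim_quotient_def using C(1) by blast
qed

end

section \<open>Cocycles on the ideal generated by a quadratic polynomial\<close>

context fd_simple_lie_algebra
begin

lemma lie_subalgebra_range_quad_mult:
  "lie_subalgebra (poly_scale scale) (poly_bracket bracket) (range (quad_mult c\<^sub>0 c\<^sub>1))"
proof -
  interpret P: lie_algebra "poly_scale scale" "poly_bracket bracket" by (rule lie_algebra_poly)
  show ?thesis
  proof
    show "P.subspace (range (quad_mult c\<^sub>0 c\<^sub>1))"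
      unfolding tensor_ideal_eq_range[symmetric] tensor_ideal_def by (rule P.subspace_span)
  qed (auto simp: quad_mult_bracket_left)
qed

lemma cocycle_on_range_quad_mult:
  fixes c\<^sub>0 c\<^sub>1 :: complex
  defines "M \<equiv> quad_mult c\<^sub>0 c\<^sub>1"
  assumes \<omega>: "\<omega> \<in> lie_cochains (poly_scale scale) 2 (range M)"
    and closed: "lie_coboundary (poly_bracket bracket) (range M) \<omega> = 0"
    and low: "\<And>b b' i j. b \<in> Basis \<Longrightarrow> b' \<in> Basis \<Longrightarrow> i \<le> 3 \<Longrightarrow> j \<le> 3 \<Longrightarrow>
      \<omega> [M (monom b i), M (monom b' j)] = 0"
  shows "\<exists>\<mu>\<in>lie_cochains (poly_scale scale) 1 (range M).
    \<omega> = lie_coboundary (poly_bracket bracket) (range M) \<mu>"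
proof -
  interpret L: lie_subalgebra "poly_scale scale" "poly_bracket bracket" "range M"
    unfolding M_def by (rule lie_subalgebra_range_quad_mult)
  define w where "w P Q = \<omega> [M P, M Q]" for P Q
  have M: "M (P + Q) = M P + M Q" "M (poly_scale scale c P) = poly_scale scale c (M P)" for c P Q
    by (simp_all add: M_def quad_mult_add quad_mult_scale)
  have inv_M: "inv M (M P) = P" for P
    unfolding M_def by (rule inv_f_f[OF inj_quad_mult])
  \<comment> \<open>One factor M is absorbed by identifying g[t] with \<open>range M\<close>; the
    other is the twist.\<close>
  have M_bracket: "poly_bracket bracket (M P) (M Q) = M (M (poly_bracket bracket P Q))" for P Q
    by (simp add: M_def quad_mult_bracket_left quad_mult_bracket_right)
  have t2: "[M P, M Q] \<in> tuples 2 (range M)" for P Q by (simp add: tuples_def)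
  have \<omega>_add: "\<omega> (us @ (X + Y) # vs) = \<omega> (us @ X # vs) + \<omega> (us @ Y # vs)"
    and \<omega>_scale: "\<omega> (us @ poly_scale scale c X # vs) = c * \<omega> (us @ X # vs)"
    if "us @ X # vs \<in> tuples 2 (range M)" "Y \<in> range M" for us X Y vs c
    using \<omega> that by (auto simp: lie_cochains_def)
  have add: "w (P + Q) R = w P R + w Q R" "w R (P + Q) = w R P + w R Q" for P Q R
    using \<omega>_add[of "[]" "M P" "[M R]" "M Q"] \<omega>_add[of "[M R]" "M P" "[]" "M Q"] t2
    by (simp_all add: w_def M)
  have scale: "w (poly_scale scale c P) Q = c * w P Q" "w Q (poly_scale scale c P) = c * w Q P" for c P Q
    using \<omega>_scale[of "[]" "M P" "[M Q]" "M P" c] \<omega>_scale[of "[M Q]" "M P" "[]" "M P" c] t2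
    by (simp_all add: w_def M)
  have self: "w P P = 0" for P
    using \<omega> t2 by (auto simp: lie_cochains_def w_def)
  have "\<exists>h. (\<forall>P Q. h (P + Q) = h P + h Q) \<and> (\<forall>c P. h (poly_scale scale c P) = c * h P) \<and>
    (\<forall>P Q. w P Q = h (quad_mult c\<^sub>0 c\<^sub>1 (poly_bracket bracket P Q)))"
  proof (rule twisted_cocycle_coboundary[OF add scale self])
    fix P Q R
    have "poly_scale scale (- 1) X = - X" for X
      by (rule poly_eqI) simp
    then have "w (M (poly_bracket bracket P R)) Q = - w (M (poly_bracket bracket R P)) Q"
      using scale(1)[of "-1" "M (poly_bracket bracket R P)" Q] M(2)[of "-1" "poly_bracket bracket R P"]
        poly_bracket_anticomm[of P R] by simp
    moreover have "lie_coboundary (poly_bracket bracket) (range M) \<omega> [M P, M Q, M R] = 0"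
      by (simp add: closed)
    then have "- w (M (poly_bracket bracket P Q)) R + w (M (poly_bracket bracket P R)) Q
        - w (M (poly_bracket bracket Q R)) P = 0"
      by (simp add: lie_coboundary_low_degree(2) M_bracket w_def)
    ultimately show "w (quad_mult c\<^sub>0 c\<^sub>1 (poly_bracket bracket P Q)) R
        + w (quad_mult c\<^sub>0 c\<^sub>1 (poly_bracket bracket Q R)) P
        + w (quad_mult c\<^sub>0 c\<^sub>1 (poly_bracket bracket R P)) Q = 0"
      unfolding M_def by algebra
  next
    fix x y and i j :: nat assume "i + j \<le> 3"
    have zero: "w 0 Q = 0" "w Q 0 = 0" for Q using add(1)[of 0 0 Q] add(2)[of Q 0 0] by simp_all
    have basis: "w (monom b i) (monom y j) = 0" if b: "b \<in> Basis" for b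
    proof -
      have "y \<in> span Basis" by (simp add: span_Basis)
      then show ?thesis
      proof (induction y rule: span_induct_alt)
        case (step c b' y)
        then have "w (monom b i) (monom b' j) = 0"
          using low[OF b, of b' i j] \<open>i + j \<le> 3\<close> by (simp add: w_def)
        with step show ?case by (simp add: add scale monom_scale flip: add_monom)
      qed (simp add: zero)
    qed
    have "x \<in> span Basis" by (simp add: span_Basis)
    then show "w (monom x i) (monom y j) = 0"
    proof (induction x rule: span_induct_alt)
      case (step c b x)
      then show ?case by (simp add: add scale monom_scale basis flip: add_monom)
    qed (simp add: zero)
  qed
  then obtain h where h: "\<And>P Q. h (P + Q) = h P + h Q" "\<And>c P. h (poly_scale scale c P) = c * h P"
    and w: "\<And>P Q. w P Q = h (M (poly_bracket bracket P Q))"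
    unfolding M_def by blast
  \<comment> \<open>The sign compensates that of \<open>lie_coboundary\<close> on 1-cochains;
    \<open>inv M\<close> strips one M from M (M [P, Q]).\<close>
  define \<mu> where "\<mu> xs = (if xs \<in> tuples 1 (range M) then - h (inv M (hd xs)) else 0)" for xs
  have \<mu>_M: "\<mu> [M P] = - h P" for P by (simp add: \<mu>_def tuples_def inv_M)
  have t1: "us @ X # vs \<in> tuples 1 (range M) \<longleftrightarrow> us = [] \<and> vs = [] \<and> X \<in> range M" for us X vs
    by (auto simp: tuples_def)
  have "\<mu> \<in> lie_cochains (poly_scale scale) 1 (range M)"
    unfolding lie_cochains_def mem_Collect_eq
  proof (intro conjI allI impI ballI)
    show "\<mu> xs = 0" if "xs \<notin> tuples 1 (range M)" for xs using that by (simp add: \<mu>_def)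
    show "\<mu> (us @ (X + Y) # vs) = \<mu> (us @ X # vs) + \<mu> (us @ Y # vs)"
      if "us @ X # vs \<in> tuples 1 (range M) \<and> Y \<in> range M" for us X Y vs
      using that unfolding t1 by (auto simp: \<mu>_M h simp flip: M)
    show "\<mu> (us @ poly_scale scale c X # vs) = c * \<mu> (us @ X # vs)"
      if "us @ X # vs \<in> tuples 1 (range M)" for us X vs c
      using that unfolding t1 by (auto simp: \<mu>_M h simp flip: M)
    show "\<mu> xs = 0" if "xs \<in> tuples 1 (range M)" "\<not> distinct xs" for xs
      using that by (cases xs) (auto simp: tuples_def)
  qed
  moreover have "\<omega> xs = lie_coboundary (poly_bracket bracket) (range M) \<mu> xs" for xs
  proof (cases "xs \<in> tuples 2 (range M)")
    case True
    then obtain X Y where "xs = [X, Y]" "X \<in> range M" "Y \<in> range M"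
      by (auto simp: tuples_def length_Suc_conv numeral_2_eq_2)
    then obtain P Q where "xs = [M P, M Q]" by blast
    then show ?thesis
      using w[of P Q] by (simp add: lie_coboundary_low_degree(1) M_bracket \<mu>_M w_def)
  next
    case False
    then have "lie_coboundary (poly_bracket bracket) (range M) \<mu> xs = 0"
      by (intro L.lie_coboundary_eq_0[of 1]) (simp_all add: \<mu>_def numeral_2_eq_2)
    with False \<omega> show ?thesis by (simp add: lie_cochains_def)
  qed
  ultimately show ?thesis by blast
qed

end

theorem theorem5p1p1:
  fixes scale :: "complex \<Rightarrow> 'g::ab_group_add \<Rightarrow> 'g"
    and bracket :: "'g \<Rightarrow> 'g \<Rightarrow> 'g"
    and a b :: complex
    and f :: "complex poly"
    and I :: "complex poly set"
  assumes "simple_lie_algebra scale bracket"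
    and "\<exists>Basis. finite_dimensional_vector_space scale Basis"
    and "a \<noteq> b"
    and "f = [:- a, 1:] * [:- b, 1:]"
    and "I = {q * f | q. True}"
  shows "finite_dim_quotient chain_scale
           (lie_homology (poly_scale scale) (poly_bracket bracket) 2 (tensor_ideal scale I))
       \<and> finite_dim_quotient cochain_scale
           (lie_cohomology (poly_scale scale) (poly_bracket bracket) 2 (tensor_ideal scale I))"
proof -
  obtain Basis where "finite_dimensional_vector_space scale Basis" using assms(2) by blast
  then interpret fd_simple_lie_algebra scale bracket Basis
    using assms(1) by (simp add: fd_simple_lie_algebra_def fd_lie_algebra_def simple_lie_algebra_def)
  let ?M = "quad_mult (a * b) (- a - b)"
  have "f = [:a * b, - a - b, 1:]" by (simp add: assms(4))
  then have L: "tensor_ideal scale I = range ?M"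
    by (simp only: assms(5) tensor_ideal_eq_range)
  interpret L: lie_subalgebra "poly_scale scale" "poly_bracket bracket" "range ?M"
    by (rule lie_subalgebra_range_quad_mult)
  \<comment> \<open>The square of exponents up to 3 contains all pairs with i + j <= 3, where the
    degree induction requires vanishing; bilinearity reduces the coefficients to
    \<open>Basis\<close>.\<close>
  define G where "G = (\<lambda>(b, b', i, j). [?M (monom b i), ?M (monom b' j)]) `
    (Basis \<times> Basis \<times> {..3::nat} \<times> {..3::nat})"
  have "finite G" unfolding G_def using finite_Basis by blast
  moreover have "G \<subseteq> tuples 2 (range ?M)" by (auto simp: G_def tuples_def)
  moreover have "\<exists>\<mu>\<in>lie_cochains (poly_scale scale) (2 - 1) (range ?M).
      \<omega> = lie_coboundary (poly_bracket bracket) (range ?M) \<mu>"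
    if "\<omega> \<in> lie_cochains (poly_scale scale) 2 (range ?M)"
      "lie_coboundary (poly_bracket bracket) (range ?M) \<omega> = 0" "\<And>xs. xs \<in> G \<Longrightarrow> \<omega> xs = 0" for \<omega>
  proof -
    have "\<omega> [?M (monom b i), ?M (monom b' j)] = 0" if "b \<in> Basis" "b' \<in> Basis" "i \<le> 3" "j \<le> 3" for b b' i j
      by (rule \<open>\<And>xs. xs \<in> G \<Longrightarrow> \<omega> xs = 0\<close>) (use that in \<open>force simp: G_def\<close>)
    from cocycle_on_range_quad_mult[OF that(1,2) this] show ?thesis by simp
  qed
  ultimately show ?thesis
    unfolding L using L.finite_dim_homology_cohomology by blast
qed

end
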